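(* Let $q\in(0,1)$, $\alpha>0$, $k\in\mathbb{N}$, $k\ge1$, and let $x_1\ge x_2\ge\cdots\ge x_k$ and $i_1<i_2<\cdots<i_k$ be integers. Let $\omega$ be a random permutation of $\mathbb{Z}$ distributed according to the Mallows product measure $\mathcal{M}^p_\alpha$. Then $$\mathbb{P}\left(\omega(i_1)\le x_1,\omega(i_2)\le x_2,\ldots,\omega(i_k)\le x_k\right)=\prod_{j=1}^k\frac{1}{1+\alpha q^{x_j-i_j+\frac12}}.$$
   Context: Fix $q\in(0,1)$. Let $\mathfrak{S}$ be the set of all bijections $\omega:\mathbb{Z}\to\mathbb{Z}$ with the $\sigma$-algebra generated by the coordinate maps $\omega\mapsto\omega(i)$. A probability measure $\mathbb{P}$ on $\mathfrak{S}$ is $q$-exchangeable if for every $i\in\mathbb{Z}$, every finite $I\subset\mathbb{Z}$ containing $i,i+1$, and all distinct integers $(y_j)_{j\in I}$: with $y'$ obtained from $y$ by swapping $y_i$ and $y_{i+1}$, one has $\mathbb{P}(\omega(j)=y'_j\ \forall j\in I)=q^{\mathrm{sign}(y_{i+1}-y_i)}\,\mathbb{P}(\omega(j)=y_j\ \forall j\in I)$. A permutation $\sigma\in\mathfrak{S}$ is balanced if $\#\{j>0:\sigma(j)\le 0\}=\#\{j\le 0:\sigma(j)>0\}<\infty$. By a theorem of Gnedin and Olshanski there is a unique $q$-exchangeable probability measure on $\mathfrak{S}$ supported on balanced permutations; it is denoted $\mathcal{M}_0$. For $c\in\mathbb{Z}$, $\mathcal{M}_c$ is the law of the permutation $i\mapsto\sigma(i)+c$,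 where $\sigma\sim\mathcal{M}_0$. With $(q;q)_\infty=\prod_{k\ge1}(1-q^k)$, the Mallows product measure with parameter $\alpha>0$ is $$\mathcal{M}^p_\alpha=\sum_{c\in\mathbb{Z}}\frac{\alpha^c q^{c^2/2}}{(q;q)_\infty\prod_{k=0}^\infty(1+\alpha q^{k+1/2})\prod_{k=0}^\infty(1+\alpha^{-1}q^{k+1/2})}\,\mathcal{M}_c$$ (the coefficients sum to $1$ by the Jacobi triple product identity). *)

theory Defs
  imports "HOL-Probability.Probability"
begin

definition perm_space :: "(int \<Rightarrow> int) measure" where
  "perm_space = sigma {\<omega>. bij \<omega>} {{\<omega>. bij \<omega> \<and> \<omega> i \<in> A} | i A. True}"

definition q_exchangeable :: "real \<Rightarrow> (int \<Rightarrow> int) measure \<Rightarrow> bool" where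
  "q_exchangeable q P \<longleftrightarrow>
     prob_space P \<and> sets P = sets perm_space \<and>
     (\<forall>i I y. finite I \<longrightarrow> i \<in> I \<longrightarrow> i + 1 \<in> I \<longrightarrow> inj_on y I \<longrightarrow>
        measure P {\<omega> \<in> space P. \<forall>j\<in>I. \<omega> j = (y(i := y (i + 1), i + 1 := y i)) j} =
        q powi sgn (y (i + 1) - y i) * measure P {\<omega> \<in> space P. \<forall>j\<in>I. \<omega> j = y j})"

definition balanced :: "(int \<Rightarrow> int) \<Rightarrow> bool" where
  "balanced \<sigma> \<longleftrightarrow>
     finite {j. j > 0 \<and> \<sigma> j \<le> 0} \<and> finite {j. j \<le> 0 \<and> \<sigma> j > 0} \<and>
     card {j. j > 0 \<and> \<sigma> j \<le> 0} = card {j. j \<le> 0 \<and> \<sigma> j > 0}"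

text \<open>The measure \<open>M\<^sub>0\<close> is characterised by this predicate: by a theorem of Gnedin and
  Olshanski, for \<open>0 < q < 1\<close> exactly one measure satisfies it.\<close>

definition is_balanced_mallows :: "real \<Rightarrow> (int \<Rightarrow> int) measure \<Rightarrow> bool" where
  "is_balanced_mallows q M \<longleftrightarrow> q_exchangeable q M \<and> (AE \<sigma> in M. balanced \<sigma>)"

definition shifted_mallows :: "(int \<Rightarrow> int) measure \<Rightarrow> int \<Rightarrow> (int \<Rightarrow> int) measure" where
  "shifted_mallows M0 c = distr M0 perm_space (\<lambda>\<sigma> i. \<sigma> i + c)"

definition mallows_weight :: "real \<Rightarrow> real \<Rightarrow> int \<Rightarrow> real" where
  "mallows_weight q \<alpha> c =
     \<alpha> powi c * q powr ((real_of_int c)\<^sup>2 / 2) /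
     ((\<Prod>k. 1 - q ^ (k + 1)) *
      (\<Prod>k. 1 + \<alpha> * q powr (real k + 1 / 2)) *
      (\<Prod>k. 1 + inverse \<alpha> * q powr (real k + 1 / 2)))"

text \<open>The sum over \<open>c\<close> is written as an integral against counting measure on the integers.\<close>

definition mallows_product :: "real \<Rightarrow> real \<Rightarrow> (int \<Rightarrow> int) measure \<Rightarrow> (int \<Rightarrow> int) measure" where
  "mallows_product q \<alpha> M0 =
     measure_of (space perm_space) (sets perm_space)
       (\<lambda>A. \<integral>\<^sup>+ c. ennreal (mallows_weight q \<alpha> c) * emeasure (shifted_mallows M0 c) A
              \<partial>count_space UNIV)"

lemma space_perm_space [simp]: "space perm_space = {\<omega>. bij \<omega>}"
  unfolding perm_space_def by (rule space_measure_of) auto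

lemma sets_mallows_product [simp]: "sets (mallows_product q \<alpha> M0) = sets perm_space"
  unfolding mallows_product_def by (rule sets.sets_measure_of_eq)

lemma space_mallows_product [simp]: "space (mallows_product q \<alpha> M0) = {\<omega>. bij \<omega>}"
  unfolding mallows_product_def by (simp only: space_measure_of_conv space_perm_space)

lemma measurable_shift_perm:
  "(\<lambda>\<sigma> i. \<sigma> i + c) \<in> measurable perm_space perm_space"
proof -
  have bij_shift: "bij (\<lambda>i. \<sigma> i + c) \<longleftrightarrow> bij \<sigma>" for \<sigma> :: "int \<Rightarrow> int"
  proof
    assume b: "bij \<sigma>"
    have "bij ((\<lambda>n. n + c) \<circ> \<sigma>)"
      using b by (intro bij_comp) (auto intro!: bij_betw_byWitness[where f' = "\<lambda>n. n - c"])
    then show "bij (\<lambda>i. \<sigma> i + c)" by (simp add: comp_def)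
  next
    assume b: "bij (\<lambda>i. \<sigma> i + c)"
    have "bij ((\<lambda>n. n - c) \<circ> (\<lambda>i. \<sigma> i + c))"
      using b by (intro bij_comp) (auto intro!: bij_betw_byWitness[where f' = "\<lambda>n. n + c"])
    then show "bij \<sigma>" by (simp add: comp_def)
  qed
  have "(\<lambda>\<sigma> i. \<sigma> i + c) \<in> measurable perm_space
          (sigma {\<omega>. bij \<omega>} {{\<omega>. bij \<omega> \<and> \<omega> i \<in> A} | i A. True})"
  proof (rule measurable_sigma_sets[OF sets_measure_of])
    fix X :: "(int \<Rightarrow> int) set"
    assume "X \<in> {{\<omega>. bij \<omega> \<and> \<omega> i \<in> A} | i A. True}"
    then obtain i A where X: "X = {\<omega>. bij \<omega> \<and> \<omega> i \<in> A}" by auto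
    have "(\<lambda>\<sigma> i. \<sigma> i + c) -` X \<inter> space perm_space
            = {\<omega>. bij \<omega> \<and> \<omega> i \<in> {n. n + c \<in> A}}"
      unfolding X by (auto simp: bij_shift)
    also have "\<dots> \<in> sets perm_space"
      unfolding perm_space_def by (subst sets_measure_of) (blast intro: sigma_sets.Basic)+
    finally show "(\<lambda>\<sigma> i. \<sigma> i + c) -` X \<inter> space perm_space \<in> sets perm_space" .
  qed (auto simp: bij_shift)
  then show ?thesis by (simp add: perm_space_def)
qed

lemma emeasure_shifted_mallows:
  assumes "sets M0 = sets perm_space" "A \<in> sets perm_space"
  shows "emeasure (shifted_mallows M0 c) A
           = emeasure M0 {\<sigma> \<in> space perm_space. (\<lambda>i. \<sigma> i + c) \<in> A}"
proof -
  have "(\<lambda>\<sigma> i. \<sigma> i + c) \<in> measurable M0 perm_space"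
    using measurable_shift_perm measurable_cong_sets[OF assms(1) refl] by blast
  then show ?thesis
    unfolding shifted_mallows_def using sets_eq_imp_space_eq[OF assms(1)] assms(2)
    by (simp add: emeasure_distr vimage_def Int_def conj_commute)
qed

lemma emeasure_mallows_product:
  assumes "A \<in> sets perm_space"
  shows "emeasure (mallows_product q \<alpha> M0) A =
    (\<integral>\<^sup>+ c. ennreal (mallows_weight q \<alpha> c) * emeasure (shifted_mallows M0 c) A \<partial>count_space UNIV)"
proof (rule emeasure_measure_of[OF mallows_product_def])
  show "sets perm_space \<subseteq> Pow (space perm_space)" by (rule sets.space_closed)
  show "A \<in> sets (mallows_product q \<alpha> M0)" using assms by simp
  show "positive (sets (mallows_product q \<alpha> M0)) (\<lambda>A. \<integral>\<^sup>+ c. ennreal (mallows_weight q \<alpha> c)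
          * emeasure (shifted_mallows M0 c) A \<partial>count_space UNIV)"
    by (simp add: positive_def)
  show "countably_additive (sets (mallows_product q \<alpha> M0))
          (\<lambda>A. \<integral>\<^sup>+ c. ennreal (mallows_weight q \<alpha> c)
          * emeasure (shifted_mallows M0 c) A \<partial>count_space UNIV)"
  proof (rule countably_additiveI)
    fix B :: "nat \<Rightarrow> (int \<Rightarrow> int) set"
    assume B: "range B \<subseteq> sets (mallows_product q \<alpha> M0)" "disjoint_family B"
    have eq: "(\<Sum>n. emeasure (shifted_mallows M0 c) (B n))
            = emeasure (shifted_mallows M0 c) (\<Union>n. B n)" for c
      by (rule suminf_emeasure) (use B in \<open>auto simp: shifted_mallows_def\<close>)
    show "(\<Sum>n. \<integral>\<^sup>+ c. ennreal (mallows_weight q \<alpha> c) * emeasure (shifted_mallows M0 c) (B n)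
             \<partial>count_space UNIV)
        = (\<integral>\<^sup>+ c. ennreal (mallows_weight q \<alpha> c) * emeasure (shifted_mallows M0 c) (\<Union>n. B n)
             \<partial>count_space UNIV)"
      by (subst nn_integral_suminf[symmetric]) (simp_all add: eq)
  qed
qed

end

theory Submission
  imports Defs
begin

text \<open>
  Removing the first inequality from the event multiplies its probability by
  \<open>1 + \<alpha> q\<^bsup>x - i + 1/2\<^esup>\<close>, where \<open>i\<close> and \<open>x\<close> are the first position and the first, hence largest,
  bound.  Repeating this strips off all factors and leaves the total mass of the product measure,
  which is 1 by the Jacobi triple product identity.

  The weights satisfy \<open>w (c + 1) = \<alpha> q\<^bsup>c + 1/2\<^esup> w c\<close>, so the factor comes from comparing the component
  shifted by \<open>c + 1\<close>, on the event that \<open>\<omega> i > x\<close>, with the component shifted by \<open>c\<close>, on the event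
  that \<open>\<omega> i \<le> x\<close>.  Both are shifts of the balanced measure \<open>M\<close>, and the comparison becomes an
  identity about \<open>M\<close> alone (\<open>prob_raise_level\<close>): for positions \<open>p j > i\<close> and bounds \<open>y j \<le> x\<close>,
  the events \<open>\<sigma> i \<ge> x, \<sigma> (p j) < y j\<close> and \<open>\<sigma> i \<le> x, \<sigma> (p j) \<le> y j\<close> have probabilities in the
  ratio \<open>q\<^bsup>x - i\<^esup>\<close>.

  To see this, split according to the set \<open>S\<close> of positions that carry a value below \<open>x\<close> (first
  event) and the set \<open>insert i S\<close> of positions that carry a value of at most \<open>x\<close> (second event),
  and according to the ranks of the values at the positions of \<open>S\<close> to the right of \<open>i\<close>.  As all
  bounds are at most \<open>x\<close>, such a cell determines whether the inequalities hold.  Two facts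
  remain.  Firstly, the ranks have a law that depends neither on the level nor on the set of
  positions, because it is built from right to left out of geometric variables
  (\<open>prob_labels\<close>).  Secondly, the probabilities of \<open>S\<close> at level \<open>x - 1\<close> and of \<open>insert i S\<close> at
  level \<open>x\<close> have the ratio \<open>q\<^bsup>x - i\<^esup>\<close>: requiring in addition that \<open>\<sigma> i = x\<close> makes the two events
  equal, and the position of the value \<open>x\<close> is geometric in both conditional laws
  (\<open>prob_level_insert\<close>); being balanced fixes the difference of the two exponents.

  All geometric laws come from one exchange rule (\<open>prob_swap\<close>): exchanging two increasing values
  costs a factor \<open>q\<close> even at distant positions, if no value at a position in between lies between them.
\<close>

section \<open>Exchanging two positions\<close>

abbreviation swap :: "int \<Rightarrow> int \<Rightarrow> int \<Rightarrow> int" where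
  "swap \<equiv> Transposition.transpose"

lemma measurable_coordinate_perm: "(\<lambda>\<sigma>. \<sigma> j) \<in> measurable perm_space (count_space UNIV)"
proof (rule measurableI)
  fix A :: "int set"
  have "(\<lambda>\<sigma>. \<sigma> j) -` A \<inter> space perm_space = {\<omega>. bij \<omega> \<and> \<omega> j \<in> A}"
    by auto
  also have "\<dots> \<in> sets perm_space"
    unfolding perm_space_def by (subst sets_measure_of) (blast intro: sigma_sets.Basic)+
  finally show "(\<lambda>\<sigma>. \<sigma> j) -` A \<inter> space perm_space \<in> sets perm_space" .
qed auto

lemma measurable_into_perm_space:
  assumes bij: "\<And>z. z \<in> space N \<Longrightarrow> bij (f z)"
    and coord: "\<And>j. (\<lambda>z. f z j) \<in> measurable N (count_space UNIV)"
  shows "f \<in> measurable N perm_space"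
  unfolding perm_space_def
proof (rule measurable_measure_of)
  fix X :: "(int \<Rightarrow> int) set"
  assume "X \<in> {{\<omega>. bij \<omega> \<and> \<omega> i \<in> A} | i A. True}"
  then obtain i A where X: "X = {\<omega>. bij \<omega> \<and> \<omega> i \<in> A}" by auto
  have "f -` X \<inter> space N = (\<lambda>z. f z i) -` A \<inter> space N"
    using bij by (auto simp: X)
  then show "f -` X \<inter> space N \<in> sets N"
    using measurable_sets[OF coord, of A i] by simp
qed (use bij in auto)

text \<open>Cylinders over index sets that contain two prescribed positions are stable under
  intersection and still generate the \<open>\<sigma>\<close>-algebra, so a measure is determined by its values on
  them.  Requiring the two positions makes the exchange relation applicable to every generator.\<close>

definition cylinder :: "int set \<Rightarrow> (int \<Rightarrow> int) \<Rightarrow> (int \<Rightarrow> int) set" where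
  "cylinder I y = {\<sigma>. bij \<sigma> \<and> (\<forall>j\<in>I. \<sigma> j = y j)}"

lemma cylinder_Int:
  "cylinder I y \<inter> cylinder J z =
     (if \<forall>j\<in>I \<inter> J. y j = z j then cylinder (I \<union> J) (\<lambda>j. if j \<in> I then y j else z j) else {})"
  by (auto simp: cylinder_def)

lemma cylinder_not_inj: "\<not> inj_on y I \<Longrightarrow> cylinder I y = {}"
  unfolding cylinder_def inj_on_def bij_def inj_def by auto metis

lemma Int_stable_cylinders: 
  assumes "a \<noteq> b"
  shows "Int_stable {cylinder I y |I y. finite I \<and> a \<in> I \<and> b \<in> I}"
proof (rule Int_stableI)
  fix X Y assume "X \<in> {cylinder I y |I y. finite I \<and> a \<in> I \<and> b \<in> I}"
    and "Y \<in> {cylinder I y |I y. finite I \<and> a \<in> I \<and> b \<in> I}"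
  then obtain I y J z where X: "X = cylinder I y" "finite I" "a \<in> I" "b \<in> I"
    and Y: "Y = cylinder J z" "finite J" "a \<in> J" "b \<in> J" by blast
  \<comment> \<open>The empty set is itself a cylinder: one that prescribes the same value twice.\<close>
  have "{} = cylinder {a, b} (\<lambda>_. 0)"
    using assms by (intro cylinder_not_inj[symmetric]) auto
  then have "\<exists>K z. X \<inter> Y = cylinder K z \<and> finite K \<and> a \<in> K \<and> b \<in> K"
    unfolding X(1) Y(1) cylinder_Int
    using X(2-4) Y(2-4)
    by (metis (no_types, lifting) finite_UnI finite.emptyI finite_insert insertCI UnI1)
  then show "X \<inter> Y \<in> {cylinder I y |I y. finite I \<and> a \<in> I \<and> b \<in> I}" by blast
qed

lemma sets_perm_space_cylinders:
  assumes "a \<noteq> b"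
  shows "sets perm_space = sigma_sets {\<sigma>. bij \<sigma>} {cylinder I y |I y. finite I \<and> a \<in> I \<and> b \<in> I}"
    (is "_ = sigma_sets ?O ?E")
proof -
  have E: "?E \<subseteq> Pow ?O" by (auto simp: cylinder_def)
  have sets_E: "sets (sigma ?O ?E) = sigma_sets ?O ?E"
    using E by (rule sets_measure_of)
  have "(\<lambda>\<sigma>. \<sigma>) \<in> measurable (sigma ?O ?E) perm_space"
  proof (rule measurable_into_perm_space)
    fix j
    show "(\<lambda>\<sigma>. \<sigma> j) \<in> measurable (sigma ?O ?E) (count_space UNIV)"
    proof (subst measurable_count_space_eq2_countable, safe)
      fix v :: int
      let ?y = "\<lambda>u w k. if k = j then v else if k = a then u else w"
      have "(\<lambda>\<sigma>. \<sigma> j) -` {v} \<inter> space (sigma ?O ?E) =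
         (\<Union>p\<in>UNIV. cylinder {a, b, j} (?y (fst p) (snd p)))" (is "?L = ?R")
      proof (intro set_eqI iffI)
        fix \<sigma> assume "\<sigma> \<in> ?L"
        then have "bij \<sigma>" "\<sigma> j = v" using E by (auto simp: space_measure_of_conv)
        then have "\<sigma> \<in> cylinder {a, b, j} (?y (\<sigma> a) (\<sigma> b))"
          using assms by (auto simp: cylinder_def)
        then show "\<sigma> \<in> ?R" by (intro UN_I[of "(\<sigma> a, \<sigma> b)"]) (simp_all only: fst_conv snd_conv UNIV_I)
      qed (use E in \<open>auto simp: space_measure_of_conv cylinder_def\<close>)
      also have "\<dots> \<in> sets (sigma ?O ?E)"
      proof (rule sets.countable_UN')
        show "(\<lambda>p. cylinder {a, b, j} (?y (fst p) (snd p))) ` UNIV \<subseteq> sets (sigma ?O ?E)"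
          unfolding sets_E by (intro image_subsetI sigma_sets.Basic) blast
      qed auto
      finally show "(\<lambda>\<sigma>. \<sigma> j) -` {v} \<inter> space (sigma ?O ?E) \<in> sets (sigma ?O ?E)" .
    qed auto
  qed (use E in \<open>simp add: space_measure_of_conv\<close>)
  then have "sets perm_space \<subseteq> sigma_sets ?O ?E"
    using E measurable_sets[of "\<lambda>\<sigma>. \<sigma>" "sigma ?O ?E" perm_space] sets.sets_into_space[of _ perm_space]
    by (auto simp: sets_E space_measure_of_conv Int_absorb2)
  moreover have "sigma_sets ?O ?E \<subseteq> sets perm_space"
  proof -
    note measurable_coordinate_perm[measurable]
    have "cylinder I y \<in> sets perm_space" if "finite I" for I y
    proof -
      have "{\<sigma> \<in> space perm_space. \<forall>j\<in>I. \<sigma> j = y j} \<in> sets perm_space"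
        using that by measurable
      then show ?thesis by (simp add: cylinder_def)
    qed
    then show ?thesis
      using sets.sigma_sets_subset[of ?E perm_space] by auto
  qed
  ultimately show ?thesis by blast
qed

locale q_exchangeable_permutation = prob_space M for M :: "(int \<Rightarrow> int) measure" +
  fixes q :: real
  assumes q_pos: "0 < q" and q_less_1: "q < 1" and exchangeable: "q_exchangeable q M"
begin

lemma sets_M [measurable_cong]: "sets M = sets perm_space"
  using exchangeable by (simp add: q_exchangeable_def)

lemma space_M [simp]: "space M = {\<sigma>. bij \<sigma>}"
  using sets_eq_imp_space_eq[OF sets_M] by simp

lemma measurable_coordinate [measurable]: "(\<lambda>\<sigma>. \<sigma> j) \<in> measurable M (count_space UNIV)"
  using measurable_coordinate_perm by (simp add: measurable_cong_sets[OF sets_M refl])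

lemma measurable_comp_perm [measurable]: 
  assumes "bij \<tau>" shows "(\<lambda>\<sigma>. \<sigma> \<circ> \<tau>) \<in> measurable M M"
proof -
  have "(\<lambda>\<sigma>. \<sigma> \<circ> \<tau>) \<in> measurable M perm_space"
    by (rule measurable_into_perm_space) (auto simp: assms bij_comp)
  then show ?thesis by (simp add: measurable_cong_sets[OF refl sets_M])
qed

lemma prob_cylinder_swap:
  assumes "finite I" "i \<in> I" "i + 1 \<in> I" "inj_on y I"
  shows "prob (cylinder I (y \<circ> swap i (i + 1))) = q powi sgn (y (i + 1) - y i) * prob (cylinder I y)"
proof -
  have "y \<circ> swap i (i + 1) = y(i := y (i + 1), i + 1 := y i)"
    by (auto simp: Transposition.transpose_def fun_eq_iff)
  then show ?thesis
    using exchangeable assms unfolding q_exchangeable_def cylinder_def space_M by simp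
qed

lemma sets_cylinder [measurable]: "finite I \<Longrightarrow> cylinder I y \<in> sets M"
proof -
  assume "finite I"
  then have "{\<sigma> \<in> space M. \<forall>j\<in>I. \<sigma> j = y j} \<in> sets M" by measurable
  then show ?thesis by (simp add: cylinder_def)
qed

text \<open>Both sides are finite measures in the event, restricted to the permutations that increase
  from \<open>i\<close> to \<open>i + 1\<close>.  On a cylinder that fixes both positions they agree by the definition of
  exchangeability, hence they agree everywhere.\<close>

lemma prob_adjacent_swap:
  assumes [measurable]: "Measurable.pred M Q" and incr: "\<And>\<sigma>. Q \<sigma> \<Longrightarrow> \<sigma> i < \<sigma> (i + 1)"
  shows "prob {\<sigma> \<in> space M. Q (\<sigma> \<circ> swap i (i + 1))} = q * prob {\<sigma> \<in> space M. Q \<sigma>}"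
proof -
  let ?\<tau> = "swap i (i + 1)"
  let ?E = "{cylinder I y |I y. finite I \<and> i \<in> I \<and> i + 1 \<in> I}"
  define up where "up = {\<sigma> \<in> space M. \<sigma> i < \<sigma> (i + 1)}"
  have [measurable]: "up \<in> sets M" unfolding up_def by measurable
  have \<tau>[measurable]: "(\<lambda>\<sigma>. \<sigma> \<circ> ?\<tau>) \<in> measurable M M" by (rule measurable_comp_perm) simp
  define N1 where "N1 = density M (\<lambda>\<sigma>. ennreal q * indicator up \<sigma>)"
  define N2 where "N2 = density (distr M M (\<lambda>\<sigma>. \<sigma> \<circ> ?\<tau>)) (indicator up)"
  have N1: "emeasure N1 A = ennreal (q * prob (up \<inter> A))" if [measurable]: "A \<in> sets M" for A
  proof -
    have "emeasure N1 A = (\<integral>\<^sup>+\<sigma>. ennreal q * indicator (up \<inter> A) \<sigma> \<partial>M)"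
      unfolding N1_def by (subst emeasure_density) (auto simp: mult.assoc indicator_inter_arith)
    then show ?thesis
      using q_pos by (simp add: nn_integral_cmult emeasure_eq_measure ennreal_mult)
  qed
  have N2: "emeasure N2 A = ennreal (prob {\<sigma> \<in> space M. \<sigma> \<circ> ?\<tau> \<in> up \<inter> A})"
    if [measurable]: "A \<in> sets M" for A
  proof -
    have "emeasure N2 A = (\<integral>\<^sup>+\<sigma>. indicator (up \<inter> A) \<sigma> \<partial>distr M M (\<lambda>\<sigma>. \<sigma> \<circ> ?\<tau>))"
      unfolding N2_def by (subst emeasure_density) (auto simp: indicator_inter_arith[symmetric] simp del: nn_integral_indicator)
    also have "\<dots> = emeasure M ((\<lambda>\<sigma>. \<sigma> \<circ> ?\<tau>) -` (up \<inter> A) \<inter> space M)"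
      by (simp add: emeasure_distr)
    also have "(\<lambda>\<sigma>. \<sigma> \<circ> ?\<tau>) -` (up \<inter> A) \<inter> space M = {\<sigma> \<in> space M. \<sigma> \<circ> ?\<tau> \<in> up \<inter> A}" by auto
    finally show ?thesis by (simp add: emeasure_eq_measure)
  qed
  let ?cover = "\<lambda>n. cylinder {i, i + 1}
    (\<lambda>j. if j = i then fst (from_nat n :: int \<times> int) else snd (from_nat n :: int \<times> int))"
  have "N1 = N2"
  proof (rule measure_eqI_generator_eq[where E = ?E and \<Omega> = "{\<sigma>. bij \<sigma>}" and A = ?cover])
    show "Int_stable ?E" by (rule Int_stable_cylinders) simp
    show "?E \<subseteq> Pow {\<sigma>. bij \<sigma>}" by (auto simp: cylinder_def)
    show "sets N1 = sigma_sets {\<sigma>. bij \<sigma>} ?E" "sets N2 = sigma_sets {\<sigma>. bij \<sigma>} ?E"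
      by (simp_all add: N1_def N2_def sets_M sets_perm_space_cylinders[of i "i + 1"])
    show "range ?cover \<subseteq> ?E"
      by blast
    show "(\<Union>n. ?cover n) = {\<sigma>. bij \<sigma>}"
    proof (safe, goal_cases)
      case (2 \<sigma>)
      then show ?case
        by (intro UN_I[of "to_nat (\<sigma> i, \<sigma> (i + 1))"]) (auto simp: cylinder_def)
    qed (auto simp: cylinder_def)
    show "emeasure N1 (?cover n) \<noteq> \<infinity>" for n
      by (subst N1) auto
  next
    fix X assume "X \<in> ?E"
    then obtain I y where X: "X = cylinder I y" and I: "finite I" "i \<in> I" "i + 1 \<in> I" by blast
    have swap: "{\<sigma> \<in> space M. \<sigma> \<circ> ?\<tau> \<in> cylinder I y} = cylinder I (y \<circ> ?\<tau>)"
    proof (intro set_eqI iffI)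
      have *: "?\<tau> j \<in> I" if "j \<in> I" for j using I that by (auto simp: Transposition.transpose_def)
      fix \<sigma> 
      show "\<sigma> \<in> {\<sigma> \<in> space M. \<sigma> \<circ> ?\<tau> \<in> cylinder I y} \<Longrightarrow> \<sigma> \<in> cylinder I (y \<circ> ?\<tau>)"
        unfolding cylinder_def space_M using * by (force dest: bspec[of I _ "?\<tau> _"])
      assume a: "\<sigma> \<in> cylinder I (y \<circ> ?\<tau>)"
      then have "\<sigma> (?\<tau> j) = y j" if "j \<in> I" for j
        using *[OF that] unfolding cylinder_def by simp
      with a show "\<sigma> \<in> {\<sigma> \<in> space M. \<sigma> \<circ> ?\<tau> \<in> cylinder I y}"
        unfolding cylinder_def by (auto intro: bij_comp)
    qed
    show "emeasure N1 X = emeasure N2 X"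
    proof (cases "inj_on y I \<and> y i < y (i + 1)")
      case True
      have "up \<inter> cylinder I y = cylinder I y"
        using True I by (auto simp: up_def cylinder_def)
      moreover have "{\<sigma> \<in> space M. \<sigma> \<circ> ?\<tau> \<in> up \<inter> cylinder I y} = cylinder I (y \<circ> ?\<tau>)"
        using calculation swap by simp
      ultimately show ?thesis
        using prob_cylinder_swap[OF I] True I by (simp add: N1 N2 X)
    next
      case False
      have "up \<inter> cylinder I y = {}"
        using False I cylinder_not_inj[of y I] by (auto simp: up_def cylinder_def)
      then show ?thesis using I by (simp add: N1 N2 X)
    qed
  qed
  then have "emeasure N1 {\<sigma> \<in> space M. Q \<sigma>} = emeasure N2 {\<sigma> \<in> space M. Q \<sigma>}" by simp
  moreover have "up \<inter> {\<sigma> \<in> space M. Q \<sigma>} = {\<sigma> \<in> space M. Q \<sigma>}" using incr by (auto simp: up_def)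
  moreover have "{\<sigma> \<in> space M. \<sigma> \<circ> ?\<tau> \<in> {\<sigma> \<in> space M. Q \<sigma>}} = {\<sigma> \<in> space M. Q (\<sigma> \<circ> ?\<tau>)}"
    by (auto simp: bij_comp)
  moreover have "{\<sigma> \<in> space M. Q \<sigma>} \<in> sets M" by measurable
  ultimately show ?thesis
    using q_pos N1[of "{\<sigma> \<in> space M. Q \<sigma>}"] N2[of "{\<sigma> \<in> space M. Q \<sigma>}"] by simp
qed

lemma prob_adjacent_swap_decr:
  assumes [measurable]: "Measurable.pred M Q" and decr: "\<And>\<sigma>. Q \<sigma> \<Longrightarrow> \<sigma> i > \<sigma> (i + 1)"
  shows "q * \<P>(\<sigma> in M. Q (\<sigma> \<circ> swap i (i + 1))) = \<P>(\<sigma> in M. Q \<sigma>)"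
proof -
  have [measurable]: "(\<lambda>\<sigma>. \<sigma> \<circ> swap i (i + 1)) \<in> measurable M M" by simp
  have "\<P>(\<sigma> in M. Q ((\<sigma> \<circ> swap i (i + 1)) \<circ> swap i (i + 1))) = q * \<P>(\<sigma> in M. Q (\<sigma> \<circ> swap i (i + 1)))"
  proof (rule prob_adjacent_swap)
    fix \<sigma> assume "Q (\<sigma> \<circ> swap i (i + 1))"
    from decr[OF this] show "\<sigma> i < \<sigma> (i + 1)" by simp
  qed measurable
  then show ?thesis by (simp add: comp_assoc)
qed

text \<open>A value at an intermediate position is either above both or below both of the exchanged
  values, so it forms as many inversions with them after the exchange as before; exactly one
  inversion is created.  In the proof the exchange is a product of three shorter ones, of which
  the first and the last contribute inverse factors.\<close>

lemma prob_swap: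
  assumes "p < p'" and "Measurable.pred M Q"
    and "\<And>\<sigma>. Q \<sigma> \<Longrightarrow> \<sigma> p < \<sigma> p'"
    and "\<And>\<sigma> j. Q \<sigma> \<Longrightarrow> p < j \<Longrightarrow> j < p' \<Longrightarrow> \<sigma> j < \<sigma> p \<or> \<sigma> p' < \<sigma> j"
  shows "\<P>(\<sigma> in M. Q (\<sigma> \<circ> swap p p')) = q * \<P>(\<sigma> in M. Q \<sigma>)"
  using assms
proof (induction "nat (p' - p)" arbitrary: p Q rule: less_induct)
  case less
  note Q[measurable] = \<open>Measurable.pred M Q\<close>
  show ?case
  proof (cases "p' = p + 1")
    case True
    then show ?thesis using prob_adjacent_swap[OF Q, of p] less.prems by simp
  next
    case False
    let ?\<tau> = "swap p (p + 1)" and ?\<rho> = "swap (p + 1) p'"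
    have p': "p + 1 < p'" using False less.prems by simp
    have [measurable]: "(\<lambda>\<sigma>. \<sigma> \<circ> ?\<tau>) \<in> measurable M M" "(\<lambda>\<sigma>. \<sigma> \<circ> ?\<rho>) \<in> measurable M M"
      "(\<lambda>\<sigma>. \<sigma> \<circ> swap p p') \<in> measurable M M"
      by simp_all
    have conj: "\<sigma> \<circ> swap p p' = ((\<sigma> \<circ> ?\<tau>) \<circ> ?\<rho>) \<circ> ?\<tau>" for \<sigma> :: "int \<Rightarrow> int"
      using p' by (auto simp: fun_eq_iff Transposition.transpose_def)
    have rho: "\<P>(\<sigma> in M. R ((\<sigma> \<circ> ?\<rho>) \<circ> ?\<tau>)) = q * \<P>(\<sigma> in M. R (\<sigma> \<circ> ?\<tau>))"
      if [measurable]: "Measurable.pred M R" and R: "\<And>\<sigma>. R \<sigma> \<Longrightarrow> Q \<sigma>" for R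
    proof (rule less.hyps[of "p + 1" "\<lambda>\<sigma>. R (\<sigma> \<circ> ?\<tau>)"])
      fix \<sigma> assume "R (\<sigma> \<circ> ?\<tau>)"
      then have Q: "Q (\<sigma> \<circ> ?\<tau>)" by (rule R)
      show "\<sigma> (p + 1) < \<sigma> p'" using less.prems(3)[OF Q] p' by (simp add: Transposition.transpose_def)
      show "\<sigma> j < \<sigma> (p + 1) \<or> \<sigma> p' < \<sigma> j" if "p + 1 < j" "j < p'" for j
        using less.prems(4)[OF Q, of j] p' that by (simp add: Transposition.transpose_def)
    qed (use p' in auto)
    \<comment> \<open>The value at \<open>p + 1\<close> is above both exchanged values (\<open>Q1\<close>) or below both (\<open>Q2\<close>); the
      factors of the first and the last exchange are \<open>q\<close> and \<open>1 / q\<close>, or \<open>1 / q\<close> and \<open>q\<close>.\<close>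
    define Q1 where "Q1 \<sigma> \<longleftrightarrow> Q \<sigma> \<and> \<sigma> p' < \<sigma> (p + 1)" for \<sigma>
    define Q2 where "Q2 \<sigma> \<longleftrightarrow> Q \<sigma> \<and> \<sigma> (p + 1) < \<sigma> p" for \<sigma>
    have [measurable]: "Measurable.pred M Q1" "Measurable.pred M Q2"
      unfolding Q1_def Q2_def by measurable
    have 1: "\<P>(\<sigma> in M. Q1 (\<sigma> \<circ> swap p p')) = q * \<P>(\<sigma> in M. Q1 \<sigma>)"
    proof -
      have "q * \<P>(\<sigma> in M. Q1 (\<sigma> \<circ> swap p p')) = \<P>(\<sigma> in M. Q1 ((\<sigma> \<circ> ?\<rho>) \<circ> ?\<tau>))"
        unfolding conj
      proof (rule prob_adjacent_swap_decr)
        fix \<sigma> assume "Q1 ((\<sigma> \<circ> ?\<rho>) \<circ> ?\<tau>)"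
        then show "\<sigma> p > \<sigma> (p + 1)"
          using p' by (auto simp: Q1_def Transposition.transpose_def)
      qed measurable
      also have "\<dots> = q * \<P>(\<sigma> in M. Q1 (\<sigma> \<circ> ?\<tau>))"
        by (rule rho) (auto simp: Q1_def)
      also have "\<P>(\<sigma> in M. Q1 (\<sigma> \<circ> ?\<tau>)) = q * \<P>(\<sigma> in M. Q1 \<sigma>)"
        by (rule prob_adjacent_swap) (use less.prems(3) in \<open>auto simp: Q1_def intro: less_trans\<close>)
      finally show ?thesis using q_pos by (simp only: mult_cancel_left) auto
    qed
    have 2: "\<P>(\<sigma> in M. Q2 (\<sigma> \<circ> swap p p')) = q * \<P>(\<sigma> in M. Q2 \<sigma>)"
    proof -
      have "\<P>(\<sigma> in M. Q2 (\<sigma> \<circ> swap p p')) = q * \<P>(\<sigma> in M. Q2 ((\<sigma> \<circ> ?\<rho>) \<circ> ?\<tau>))"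
        unfolding conj
      proof (rule prob_adjacent_swap)
        fix \<sigma> assume "Q2 ((\<sigma> \<circ> ?\<rho>) \<circ> ?\<tau>)"
        then show "\<sigma> p < \<sigma> (p + 1)"
          using p' less.prems(3)[of "(\<sigma> \<circ> ?\<rho>) \<circ> ?\<tau>"] by (auto simp: Q2_def Transposition.transpose_def)
      qed measurable
      also have "\<P>(\<sigma> in M. Q2 ((\<sigma> \<circ> ?\<rho>) \<circ> ?\<tau>)) = q * \<P>(\<sigma> in M. Q2 (\<sigma> \<circ> ?\<tau>))"
        by (rule rho) (auto simp: Q2_def)
      also have "q * \<P>(\<sigma> in M. Q2 (\<sigma> \<circ> ?\<tau>)) = \<P>(\<sigma> in M. Q2 \<sigma>)"
        by (rule prob_adjacent_swap_decr) (auto simp: Q2_def)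
      finally show ?thesis .
    qed
    have Q: "Q \<sigma> \<longleftrightarrow> Q1 \<sigma> \<or> Q2 \<sigma>" for \<sigma>
      using less.prems(4)[of \<sigma> "p + 1"] p' by (auto simp: Q1_def Q2_def)
    have disj: "\<not> (Q1 \<sigma> \<and> Q2 \<sigma>)" for \<sigma>
      using less.prems(3)[of \<sigma>] by (auto simp: Q1_def Q2_def)
    have split: "\<P>(\<sigma> in M. R1 \<sigma> \<or> R2 \<sigma>) = \<P>(\<sigma> in M. R1 \<sigma>) + \<P>(\<sigma> in M. R2 \<sigma>)"
      if [measurable]: "Measurable.pred M R1" "Measurable.pred M R2" and "\<And>\<sigma>. \<not> (R1 \<sigma> \<and> R2 \<sigma>)" for R1 R2
    proof -
      have "{\<sigma> \<in> space M. R1 \<sigma>} \<in> sets M" "{\<sigma> \<in> space M. R2 \<sigma>} \<in> sets M" by measurable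
      from finite_measure_Union[OF this] show ?thesis
        using that(3) by (simp add: disjoint_iff Collect_disj_eq[symmetric] conj_disj_distribL[symmetric])
    qed
    have [measurable]: "Measurable.pred M (\<lambda>\<sigma>. Q1 (\<sigma> \<circ> swap p p'))" "Measurable.pred M (\<lambda>\<sigma>. Q2 (\<sigma> \<circ> swap p p'))"
      by measurable
    have "\<P>(\<sigma> in M. Q (\<sigma> \<circ> swap p p')) =
        \<P>(\<sigma> in M. Q1 (\<sigma> \<circ> swap p p')) + \<P>(\<sigma> in M. Q2 (\<sigma> \<circ> swap p p'))"
      unfolding Q by (rule split) (fact | rule disj)+
    moreover have "\<P>(\<sigma> in M. Q \<sigma>) = \<P>(\<sigma> in M. Q1 \<sigma>) + \<P>(\<sigma> in M. Q2 \<sigma>)"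
      unfolding Q by (rule split) (fact | rule disj)+
    ultimately show ?thesis using 1 2 by (simp add: algebra_simps)
  qed
qed

end

section \<open>Summation over countable partitions\<close>

text \<open>The events compared below are not images of each other under one exchange of positions;
  they are unions of cells, indexed by the same countable set, whose probabilities are
  proportional cell by cell.\<close>

lemma (in prob_space) prob_scale_by_partition:
  assumes c: "0 \<le> c" and I: "countable I"
    and [measurable]: "Measurable.pred M A" "Measurable.pred M B"
    and f: "\<And>i. i \<in> I \<Longrightarrow> Measurable.pred M (\<lambda>z. A z \<and> f z = i)"
    and g: "\<And>i. i \<in> I \<Longrightarrow> Measurable.pred M (\<lambda>z. B z \<and> g z = i)"
    and fI: "AE z in M. A z \<longrightarrow> f z \<in> I" and gI: "AE z in M. B z \<longrightarrow> g z \<in> I"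
    and eq: "\<And>i. i \<in> I \<Longrightarrow> \<P>(z in M. A z \<and> f z = i) = c * \<P>(z in M. B z \<and> g z = i)"
  shows "\<P>(z in M. A z) = c * \<P>(z in M. B z)"
proof -
  have sum: "emeasure M {z \<in> space M. A z} = (\<integral>\<^sup>+i. emeasure M {z \<in> space M. A z \<and> f z = i} \<partial>count_space I)"
    if A[measurable]: "Measurable.pred M A" and f: "\<And>i. i \<in> I \<Longrightarrow> Measurable.pred M (\<lambda>z. A z \<and> f z = i)"
      and "AE z in M. A z \<longrightarrow> f z \<in> I" for A and f :: "'a \<Rightarrow> 'b"
  proof -
    have "emeasure M {z \<in> space M. A z} = emeasure M (\<Union>i\<in>I. {z \<in> space M. A z \<and> f z = i})"
    proof (rule emeasure_eq_AE)
      show "AE z in M. z \<in> {z \<in> space M. A z} \<longleftrightarrow> z \<in> (\<Union>i\<in>I. {z \<in> space M. A z \<and> f z = i})"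
        using that(3) by eventually_elim auto
      show "(\<Union>i\<in>I. {z \<in> space M. A z \<and> f z = i}) \<in> sets M"
        using I f by (intro sets.countable_UN') auto
    qed measurable
    also have "\<dots> = (\<integral>\<^sup>+i. emeasure M {z \<in> space M. A z \<and> f z = i} \<partial>count_space I)"
      using I f by (intro emeasure_UN_countable) (auto simp: disjoint_family_on_def)
    finally show ?thesis .
  qed
  have "emeasure M {z \<in> space M. A z} = (\<integral>\<^sup>+i. emeasure M {z \<in> space M. A z \<and> f z = i} \<partial>count_space I)"
    by (rule sum) (use f fI in auto)
  also have "\<dots> = (\<integral>\<^sup>+i. ennreal c * emeasure M {z \<in> space M. B z \<and> g z = i} \<partial>count_space I)"
    using eq c by (intro nn_integral_cong) (auto simp: emeasure_eq_measure ennreal_mult)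
  also have "\<dots> = ennreal c * (\<integral>\<^sup>+i. emeasure M {z \<in> space M. B z \<and> g z = i} \<partial>count_space I)"
    by (rule nn_integral_cmult) simp
  also have "(\<integral>\<^sup>+i. emeasure M {z \<in> space M. B z \<and> g z = i} \<partial>count_space I) = emeasure M {z \<in> space M. B z}"
    by (rule sum[symmetric]) (use g gI in auto)
  finally show ?thesis using c by (simp add: emeasure_eq_measure ennreal_mult[symmetric])
qed

text \<open>Listed in increasing order of their indices, the events have geometrically decaying
  probabilities, so each of them is a known fraction of their union.\<close>

lemma (in prob_space) prob_geometric_partition:
  fixes N :: "nat set"
  assumes q: "0 < q" "q < 1" and N: "infinite N"
    and A: "\<And>n. n \<in> N \<Longrightarrow> A n \<in> sets M" and disj: "disjoint_family_on A N"
    and step: "\<And>n n'. n \<in> N \<Longrightarrow> n' \<in> N \<Longrightarrow> n < n' \<Longrightarrow> N \<inter> {n<..<n'} = {} \<Longrightarrow> prob (A n') = q * prob (A n)"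
    and n: "n \<in> N"
  shows "prob (A n) = (1 - q) * q ^ card (N \<inter> {..<n}) * prob (\<Union>n\<in>N. A n)"
proof -
  let ?e = "enumerate N"
  have e: "?e k \<in> N" "k < l \<Longrightarrow> ?e k < ?e l" for k l
    using N by (auto intro: enumerate_in_set)
  have inj: "inj ?e" using e(2) by (metis injI less_irrefl linorder_neqE_nat)
  have range: "range ?e = N" using N by (rule range_enumerate)
  have power: "prob (A (?e k)) = q ^ k * prob (A (?e 0))" for k
  proof (induction k)
    case (Suc k)
    have "\<not> (?e k < ?e l \<and> ?e l < ?e (Suc k))" for l
      using N by simp
    then have "m \<notin> {?e k<..<?e (Suc k)}" if "m \<in> N" for m
      using that range by (metis greaterThanLessThan_iff rangeE)
    then have "N \<inter> {?e k<..<?e (Suc k)} = {}" by blast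
    then have "prob (A (?e (Suc k))) = q * prob (A (?e k))"
      using e by (intro step) auto
    then show ?case using Suc by simp
  qed simp
  have "(\<lambda>k. prob (A (?e k))) sums prob (\<Union>k. A (?e k))"
  proof (rule finite_measure_UNION)
    show "disjoint_family (\<lambda>k. A (?e k))"
      unfolding disjoint_family_on_def
    proof (intro ballI impI)
      fix k l :: nat assume "k \<noteq> l"
      then have "?e k \<noteq> ?e l" using inj by (auto dest: injD)
      then show "A (?e k) \<inter> A (?e l) = {}" using disj e by (auto simp: disjoint_family_on_def)
    qed
  qed (use e A in auto)
  moreover have "(\<lambda>k. prob (A (?e k))) sums (1 / (1 - q) * prob (A (?e 0)))"
  proof -
    have "(\<lambda>k. prob (A (?e k))) = (\<lambda>k. q ^ k * prob (A (?e 0)))"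
      by (rule ext) (rule power)
    then show ?thesis using q by (simp only:) (intro sums_mult2 geometric_sums, auto)
  qed
  moreover have "(\<Union>k. A (?e k)) = (\<Union>n\<in>N. A n)"
  proof -
    have "(\<Union>k. A (?e k)) = (\<Union>n\<in>range ?e. A n)" by simp
    then show ?thesis unfolding range .
  qed
  ultimately have "prob (\<Union>n\<in>N. A n) = 1 / (1 - q) * prob (A (?e 0))"
    using sums_unique2 by metis
  then have 0: "prob (A (?e 0)) = (1 - q) * prob (\<Union>n\<in>N. A n)"
    using q by simp
  obtain k where k: "n = ?e k" using n range by auto
  have "N \<inter> {..<n} = ?e ` {..<k}"
  proof (intro set_eqI iffI)
    fix m assume m: "m \<in> N \<inter> {..<n}"
    then obtain l where "m = ?e l" using range by blast
    with m N show "m \<in> ?e ` {..<k}" by (auto simp: k)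
  qed (use N e k in auto)
  moreover have "inj_on ?e {..<k}" using inj by (rule inj_on_subset) simp
  ultimately have "card (N \<inter> {..<n}) = k" by (simp add: card_image)
  then show ?thesis using power[of k] 0 by (simp add: k)
qed

lemma (in prob_space) prob_geometric_descending:
  fixes S :: "int set"
  assumes q: "0 < q" "q < 1" and S: "infinite S" "S \<subseteq> {..b}"
    and A: "\<And>s. s \<in> S \<Longrightarrow> A s \<in> sets M" and disj: "disjoint_family_on A S"
    and step: "\<And>s s'. s \<in> S \<Longrightarrow> s' \<in> S \<Longrightarrow> s' < s \<Longrightarrow> S \<inter> {s'<..<s} = {} \<Longrightarrow> prob (A s') = q * prob (A s)"
    and s: "s \<in> S"
  shows "prob (A s) = (1 - q) * q ^ card (S \<inter> {s<..}) * prob (\<Union>s\<in>S. A s)"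
proof -
  define N where "N = {n. b - int n \<in> S}"
  have nat: "b - int (nat (b - t)) = t" "nat (b - t) \<in> N" if "t \<in> S" for t
    using that S(2) by (auto simp: N_def)
  have img: "(\<lambda>n. b - int n) ` N = S"
  proof (intro set_eqI iffI)
    fix t assume "t \<in> S"
    from nat[OF this] show "t \<in> (\<lambda>n. b - int n) ` N" by (metis imageI)
  qed (auto simp: N_def)
  have "(\<lambda>n. b - int n) ` (N \<inter> {..<nat (b - s)}) = S \<inter> {s<..}"
  proof (intro set_eqI iffI)
    fix t assume t: "t \<in> S \<inter> {s<..}"
    then have "nat (b - t) \<in> N \<inter> {..<nat (b - s)}" "t = b - int (nat (b - t))"
      using nat[of t] S(2) s by auto
    then show "t \<in> (\<lambda>n. b - int n) ` (N \<inter> {..<nat (b - s)})" by blast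
  qed (auto simp: N_def)
  then have card: "card (N \<inter> {..<nat (b - s)}) = card (S \<inter> {s<..})"
    using card_image[of "\<lambda>n. b - int n" "N \<inter> {..<nat (b - s)}"] by (simp add: inj_on_def)
  have union: "(\<Union>n\<in>N. A (b - int n)) = (\<Union>s\<in>S. A s)"
    unfolding img[symmetric] by simp
  have "prob (A (b - int (nat (b - s)))) = (1 - q) * q ^ card (N \<inter> {..<nat (b - s)}) * prob (\<Union>n\<in>N. A (b - int n))"
  proof (rule prob_geometric_partition[OF q])
    show "infinite N" using S(1) img finite_imageI by metis
    show "disjoint_family_on (\<lambda>n. A (b - int n)) N"
      using disj by (auto simp: disjoint_family_on_def N_def)
    fix n n' assume n: "n \<in> N" "n' \<in> N" "n < n'" "N \<inter> {n<..<n'} = {}"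
    have "S \<inter> {b - int n'<..<b - int n} = {}"
    proof (safe, goal_cases)
      case (1 t)
      then have "nat (b - t) \<in> N \<inter> {n<..<n'}" using nat[of t] by auto
      then show ?case using n by auto
    qed
    then show "prob (A (b - int n')) = q * prob (A (b - int n))"
      using n by (intro step) (auto simp: N_def)
  qed (use A nat s in \<open>auto simp: N_def\<close>)
  then show ?thesis unfolding card union using nat[OF s] by simp
qed

lemma (in prob_space) prob_geometric_ascending:
  fixes S :: "int set"
  assumes q: "0 < q" "q < 1" and S: "infinite S" "S \<subseteq> {a..}"
    and A: "\<And>s. s \<in> S \<Longrightarrow> A s \<in> sets M" and disj: "disjoint_family_on A S"
    and step: "\<And>s s'. s \<in> S \<Longrightarrow> s' \<in> S \<Longrightarrow> s < s' \<Longrightarrow> S \<inter> {s<..<s'} = {} \<Longrightarrow> prob (A s') = q * prob (A s)"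
    and s: "s \<in> S"
  shows "prob (A s) = (1 - q) * q ^ card (S \<inter> {..<s}) * prob (\<Union>s\<in>S. A s)"
proof -
  have img: "uminus ` S \<inter> {- t<..} = uminus ` (S \<inter> {..<t})" for t by force
  have "prob (A (- (- s))) = (1 - q) * q ^ card (uminus ` S \<inter> {- s<..}) * prob (\<Union>t\<in>uminus ` S. A (- t))"
  proof (rule prob_geometric_descending[OF q])
    show "infinite (uminus ` S)" using S(1) by (simp add: finite_image_iff)
    show "uminus ` S \<subseteq> {..- a}" using S(2) by auto
    show "disjoint_family_on (\<lambda>t. A (- t)) (uminus ` S)"
      using disj by (auto simp: disjoint_family_on_def)
    fix t t' assume t: "t \<in> uminus ` S" "t' \<in> uminus ` S" "t' < t" "uminus ` S \<inter> {t'<..<t} = {}"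
    have "S \<inter> {- t<..<- t'} = {}"
    proof (safe, goal_cases)
      case (1 u)
      then have "- u \<in> uminus ` S \<inter> {t'<..<t}" by auto
      then show ?case using t by auto
    qed
    then show "prob (A (- t')) = q * prob (A (- t))"
      using t by (intro step) auto
  qed (use A s in auto)
  then show ?thesis unfolding img by (simp add: card_image)
qed

section \<open>The set of positions carrying small values\<close>

definition level :: "int \<Rightarrow> (int \<Rightarrow> int) \<Rightarrow> int set" where
  "level x \<sigma> = {j. \<sigma> j \<le> x}"

lemma bij_comp_swap [simp]: "bij (\<sigma> \<circ> swap p p') \<longleftrightarrow> bij \<sigma>"
proof
  assume "bij (\<sigma> \<circ> swap p p')"
  then have "bij ((\<sigma> \<circ> swap p p') \<circ> swap p p')" by (rule bij_comp[rotated]) simp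
  then show "bij \<sigma>" by (simp add: comp_assoc)
qed (simp add: bij_comp)

lemma level_comp_swap:
  assumes "p \<in> S \<longleftrightarrow> p' \<in> S" shows "level x (\<sigma> \<circ> swap p p') = S \<longleftrightarrow> level x \<sigma> = S"
proof -
  have "swap p p' -` S = S" using assms by (auto simp: Transposition.transpose_def split: if_splits)
  moreover have "level x (\<sigma> \<circ> swap p p') = swap p p' -` level x \<sigma>" by (auto simp: level_def)
  moreover have "surj (swap p p')" by (simp add: bij_is_surj)
  ultimately show ?thesis by (metis surj_image_vimage_eq)
qed

lemma level_insert:
  assumes "bij \<sigma>" "\<sigma> s = x" shows "level x \<sigma> = insert s (level (x - 1) \<sigma>)" "s \<notin> level (x - 1) \<sigma>"
proof -
  have "\<sigma> j = x \<longleftrightarrow> j = s" for j using assms by (auto dest: bij_is_inj injD)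
  then have "\<sigma> j \<le> x \<longleftrightarrow> j = s \<or> \<sigma> j \<le> x - 1" for j by (metis zle_add1_eq_le le_less diff_add_cancel)
  then show "level x \<sigma> = insert s (level (x - 1) \<sigma>)" unfolding level_def by blast
  show "s \<notin> level (x - 1) \<sigma>" using assms by (simp add: level_def)
qed

text \<open>The difference between the number of positions of \<open>S\<close> to the right of \<open>i\<close> and the number of
  gaps of \<open>S\<close> up to \<open>i\<close>, as for particle configurations that are full far to the left and empty
  far to the right.  A permutation is balanced iff its level set at 0 has charge 0 about 0.\<close>

definition has_charge :: "int \<Rightarrow> int set \<Rightarrow> int \<Rightarrow> bool" where
  "has_charge i S d \<longleftrightarrow> finite (S \<inter> {i<..}) \<and> finite ({..i} - S) \<and>
     int (card (S \<inter> {i<..})) - int (card ({..i} - S)) = d"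

lemma has_charge_insert:
  assumes "s \<notin> S" shows "has_charge i (insert s S) (d + 1) \<longleftrightarrow> has_charge i S d"
proof (cases "i < s")
  case True
  then have 1: "insert s S \<inter> {i<..} = insert s (S \<inter> {i<..})" "{..i} - insert s S = {..i} - S" by auto
  show ?thesis unfolding has_charge_def 1 using assms by (auto simp: card_insert_if)
next
  case False
  then have 1: "insert s S \<inter> {i<..} = S \<inter> {i<..}" "{..i} - S = insert s ({..i} - insert s S)"
    using assms by auto
  show ?thesis unfolding has_charge_def 1 by (auto simp: card_insert_if)
qed

lemma has_charge_Suc: "has_charge (i + 1) S (d - 1) \<longleftrightarrow> has_charge i S d"
proof -
  have split: "{..i + 1} = insert (i + 1) {..i}" "{i<..} = insert (i + 1) {i + 1<..}" by auto
  show ?thesis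
  proof (cases "i + 1 \<in> S")
  case True
  then have 1: "S \<inter> {i<..} = insert (i + 1) (S \<inter> {i + 1<..})" and 2: "{..i + 1} - S = {..i} - S"
      by (auto simp: split)
    show ?thesis unfolding has_charge_def 1 2 by (auto simp: card_insert_if)
  next
    case False
    then have 1: "S \<inter> {i<..} = S \<inter> {i + 1<..}" and 2: "{..i + 1} - S = insert (i + 1) ({..i} - S)"
      by (auto simp: split)
    show ?thesis unfolding has_charge_def 1 2 by (auto simp: card_insert_if)
  qed
qed

text \<open>All levels and reference points are reached from 0 in unit steps: raising the level adds one
  position to the level set, and moving the reference point to the right lowers the charge by one.\<close>

lemma balanced_has_charge:
  assumes "bij \<sigma>" "balanced \<sigma>"
  shows "has_charge i (level x \<sigma>) (x - i)"
proof -
  have "level 0 \<sigma> \<inter> {0<..} = {j. j > 0 \<and> \<sigma> j \<le> 0}" "{..0} - level 0 \<sigma> = {j. j \<le> 0 \<and> \<sigma> j > 0}"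
    by (auto simp: level_def)
  then have 0: "has_charge 0 (level 0 \<sigma>) 0"
    using assms(2) by (simp add: balanced_def has_charge_def)
  have step: "has_charge 0 (level x \<sigma>) (d + 1) \<longleftrightarrow> has_charge 0 (level (x - 1) \<sigma>) d" for x d
  proof -
    obtain s where "\<sigma> s = x" using assms(1) by (metis bij_pointE)
    from level_insert[OF assms(1) this] show ?thesis using has_charge_insert by metis
  qed
  have "has_charge 0 (level x \<sigma>) x"
  proof (induction x rule: int_induct[where k = 0])
    case (step1 x)
    then show ?case using step[of "x + 1" x] by simp
  next
    case (step2 x)
    then show ?case using step[of x "x - 1"] by simp
  qed (use 0 in simp)
  then show ?thesis
  proof (induction i rule: int_induct[where k = 0])
    case (step1 i)
    then show ?case using has_charge_Suc[of i "level x \<sigma>" "x - i"] by (simp add: algebra_simps)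
  next
    case (step2 i)
    then show ?case using has_charge_Suc[of "i - 1" "level x \<sigma>" "x - i + 1"] by (simp add: algebra_simps)
  qed simp
qed

lemma countable_has_charge: "countable {S. has_charge i S d}"
proof -
  let ?F = "{A :: int set. finite A}"
  have "{S. has_charge i S d} \<subseteq> (\<lambda>(A, B). ({..i} - B) \<union> A) ` (?F \<times> ?F)"
  proof
    fix S assume "S \<in> {S. has_charge i S d}"
    then have "(S \<inter> {i<..}, {..i} - S) \<in> ?F \<times> ?F" by (simp add: has_charge_def)
    moreover have "S = (\<lambda>(A, B). ({..i} - B) \<union> A) (S \<inter> {i<..}, {..i} - S)" by auto
    ultimately show "S \<in> (\<lambda>(A, B). ({..i} - B) \<union> A) ` (?F \<times> ?F)" by blast
  qed
  then show ?thesis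
    by (rule countable_subset) (intro countable_image countable_SIGMA countable_Collect_finite)
qed

context q_exchangeable_permutation
begin

lemma measurable_bij [measurable]: "Measurable.pred M bij"
  using sets.top[of M] by (simp add: pred_def)

lemma measurable_level [measurable]: "Measurable.pred M (\<lambda>\<sigma>. level x \<sigma> = S)"
  unfolding level_def set_eq_iff mem_Collect_eq by measurable

text \<open>Given the level set, the position of its largest value is geometric, counted from the right:
  moving that value to the next position of \<open>S\<close> on the left crosses only values above the level,
  so the exchange rule applies.\<close>

lemma prob_max_position:
  assumes s: "s \<in> S" and S: "infinite S" "finite (S \<inter> {s<..})"
  shows "\<P>(\<sigma> in M. level x \<sigma> = S \<and> \<sigma> s = x) = (1 - q) * q ^ card (S \<inter> {s<..}) * \<P>(\<sigma> in M. level x \<sigma> = S)"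
proof -
  let ?A = "\<lambda>s. {\<sigma> \<in> space M. level x \<sigma> = S \<and> \<sigma> s = x}"
  have "S \<subseteq> {..Max (insert s (S \<inter> {s<..}))}"
  proof
    fix t assume "t \<in> S"
    then show "t \<in> {..Max (insert s (S \<inter> {s<..}))}"
      using S(2) by (cases "s < t") (auto intro: Max_ge order.trans[of t s])
  qed
  from q_pos q_less_1 S(1) this have "prob (?A s) = (1 - q) * q ^ card (S \<inter> {s<..}) * prob (\<Union>s\<in>S. ?A s)"
  proof (rule prob_geometric_descending)
    show "disjoint_family_on ?A S"
      by (auto simp: disjoint_family_on_def dest: bij_is_inj injD)
  next
    fix t t' assume t: "t \<in> S" "t' \<in> S" "t' < t" "S \<inter> {t'<..<t} = {}"
    let ?Q = "\<lambda>\<sigma>. bij \<sigma> \<and> level x \<sigma> = S \<and> \<sigma> t = x"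
    have "\<P>(\<sigma> in M. ?Q (\<sigma> \<circ> swap t' t)) = q * \<P>(\<sigma> in M. ?Q \<sigma>)"
    proof (rule prob_swap)
      fix \<sigma> assume Q: "?Q \<sigma>"
      then have "\<sigma> t' \<noteq> \<sigma> t" using t(3) by (auto dest!: bij_is_inj dest: injD)
      moreover have "\<sigma> t' \<le> x" using Q t(2) by (auto simp: level_def)
      ultimately show "\<sigma> t' < \<sigma> t" using Q by simp
      show "\<sigma> j < \<sigma> t' \<or> \<sigma> t < \<sigma> j" if "t' < j" "j < t" for j
        using Q t(4) that unfolding level_def by fastforce
    qed (use t in \<open>auto\<close>)
    then show "prob (?A t') = q * prob (?A t)"
      using t by (simp add: level_comp_swap)
  next
    show "?A t \<in> sets M" for t by measurable
  qed (use s in auto)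
  also have "(\<Union>s\<in>S. ?A s) = {\<sigma> \<in> space M. level x \<sigma> = S}"
  proof (intro set_eqI iffI)
    fix \<sigma> assume a: "\<sigma> \<in> {\<sigma> \<in> space M. level x \<sigma> = S}"
    then obtain t where t: "\<sigma> t = x" by (metis (no_types, lifting) bij_pointE space_M mem_Collect_eq)
    then have "t \<in> level x \<sigma>" by (simp add: level_def)
    then show "\<sigma> \<in> (\<Union>s\<in>S. ?A s)" using a t by auto
  qed auto
  finally show ?thesis .
qed

text \<open>The mirror image: the least value above the level is at a geometric position of the
  complement, counted from the left.\<close>

lemma prob_min_position:
  assumes s: "s \<notin> S" and S: "infinite (- S)" "finite ({..<s} - S)"
  shows "\<P>(\<sigma> in M. level (x - 1) \<sigma> = S \<and> \<sigma> s = x) = (1 - q) * q ^ card ({..<s} - S) * \<P>(\<sigma> in M. level (x - 1) \<sigma> = S)"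
proof -
  let ?A = "\<lambda>s. {\<sigma> \<in> space M. level (x - 1) \<sigma> = S \<and> \<sigma> s = x}"
  have "- S \<subseteq> {Min (insert s ({..<s} - S))..}"
  proof
    fix t assume "t \<in> - S"
    then show "t \<in> {Min (insert s ({..<s} - S))..}"
      using S(2) by (cases "t < s") (auto intro: Min_le order.trans[of _ s t])
  qed
  from q_pos q_less_1 S(1) this have "prob (?A s) = (1 - q) * q ^ card (- S \<inter> {..<s}) * prob (\<Union>s\<in>- S. ?A s)"
  proof (rule prob_geometric_ascending)
    show "disjoint_family_on ?A (- S)"
      by (auto simp: disjoint_family_on_def dest: bij_is_inj injD)
  next
    fix t t' assume t: "t \<in> - S" "t' \<in> - S" "t < t'" "- S \<inter> {t<..<t'} = {}"
    let ?Q = "\<lambda>\<sigma>. bij \<sigma> \<and> level (x - 1) \<sigma> = S \<and> \<sigma> t = x"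
    have "\<P>(\<sigma> in M. ?Q (\<sigma> \<circ> swap t t')) = q * \<P>(\<sigma> in M. ?Q \<sigma>)"
    proof (rule prob_swap)
      fix \<sigma> assume Q: "?Q \<sigma>"
      then have "\<sigma> t' \<noteq> \<sigma> t" using t(3) by (auto dest!: bij_is_inj dest: injD)
      moreover have "\<not> \<sigma> t' \<le> x - 1" using Q t(2) by (auto simp: level_def)
      ultimately show "\<sigma> t < \<sigma> t'" using Q by simp
      show "\<sigma> j < \<sigma> t \<or> \<sigma> t' < \<sigma> j" if "t < j" "j < t'" for j
        using Q t(4) that unfolding level_def by fastforce
    qed (use t in \<open>auto\<close>)
    then show "prob (?A t') = q * prob (?A t)"
      using t by (simp add: level_comp_swap)
  next
    show "?A t \<in> sets M" for t by measurable
  qed (use s in auto)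
  also have "(\<Union>s\<in>- S. ?A s) = {\<sigma> \<in> space M. level (x - 1) \<sigma> = S}"
  proof (intro set_eqI iffI)
    fix \<sigma> assume a: "\<sigma> \<in> {\<sigma> \<in> space M. level (x - 1) \<sigma> = S}"
    then obtain t where t: "\<sigma> t = x" by (metis (no_types, lifting) bij_pointE space_M mem_Collect_eq)
    then have "t \<notin> level (x - 1) \<sigma>" by (simp add: level_def)
    then show "\<sigma> \<in> (\<Union>s\<in>- S. ?A s)" using a t by auto
  qed auto
  also have "- S \<inter> {..<s} = {..<s} - S" by auto
  finally show ?thesis .
qed

text \<open>The events that the level set is \<open>S\<close> at \<open>x - 1\<close> and \<open>insert i S\<close> at \<open>x\<close> become equal once
  \<open>\<sigma> i = x\<close> is required.  Their conditional probabilities of \<open>\<sigma> i = x\<close> are the two geometric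
  weights just found, whose normalising factors \<open>1 - q\<close> cancel.\<close>

lemma prob_level_insert:
  assumes i: "i \<notin> S" and S: "finite (S \<inter> {i<..})" "finite ({..<i} - S)"
  shows "q ^ card ({..<i} - S) * \<P>(\<sigma> in M. level (x - 1) \<sigma> = S) =
    q ^ card (S \<inter> {i<..}) * \<P>(\<sigma> in M. level x \<sigma> = insert i S)"
proof -
  have ins: "insert i S \<inter> {i<..} = S \<inter> {i<..}" by auto
  have "infinite (- S)"
  proof
    assume "finite (- S)"
    then have "finite (S \<inter> {i<..} \<union> - S)" using S by simp
    then have "finite {i<..}" by (rule rev_finite_subset) auto
    then show False by (simp add: infinite_Ioi)
  qed
  moreover have "infinite S"
  proof
    assume "finite S"
    then have "finite ({..<i} - S \<union> S)" using S by simp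
    then have "finite {..<i}" by (rule rev_finite_subset) auto
    then show False by (simp add: infinite_Iio)
  qed
  moreover have "{\<sigma> \<in> space M. level (x - 1) \<sigma> = S \<and> \<sigma> i = x} = {\<sigma> \<in> space M. level x \<sigma> = insert i S \<and> \<sigma> i = x}"
    using i level_insert by (auto simp: insert_ident)
  ultimately have "(1 - q) * q ^ card ({..<i} - S) * \<P>(\<sigma> in M. level (x - 1) \<sigma> = S) =
    (1 - q) * q ^ card (S \<inter> {i<..}) * \<P>(\<sigma> in M. level x \<sigma> = insert i S)"
    using prob_min_position[of i S x] prob_max_position[of i "insert i S" x] assms by (simp add: ins)
  then show ?thesis using q_less_1 by simp
qed

text \<open>Partition by the random position of one prescribed value.\<close>

lemma prob_scale_by_position:
  assumes c: "0 \<le> c" and AB [measurable]: "Measurable.pred M A" "Measurable.pred M B"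
    and eq: "\<And>p. \<P>(\<sigma> in M. A \<sigma> \<and> \<sigma> p = v) = c * \<P>(\<sigma> in M. B \<sigma> \<and> \<sigma> p = w)"
  shows "\<P>(\<sigma> in M. A \<sigma>) = c * \<P>(\<sigma> in M. B \<sigma>)"
proof -
  have inv: "inv \<sigma> v = p \<longleftrightarrow> \<sigma> p = v" if "\<sigma> \<in> space M" for \<sigma> v p
    using that bij_inv_eq_iff[of \<sigma> p v] by auto
  have set: "{\<sigma> \<in> space M. A \<sigma> \<and> inv \<sigma> v = p} = {\<sigma> \<in> space M. A \<sigma> \<and> \<sigma> p = v}" for A v p
    using inv by auto
  have meas: "Measurable.pred M (\<lambda>\<sigma>. A \<sigma> \<and> inv \<sigma> v = p)" if [measurable]: "Measurable.pred M A" for A v p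
  proof -
    have "{\<sigma> \<in> space M. A \<sigma> \<and> \<sigma> p = v} \<in> sets M" by measurable
    then show ?thesis unfolding pred_def set .
  qed
  show ?thesis
    by (rule prob_scale_by_partition[OF c countableI_type AB, where f = "\<lambda>\<sigma>. inv \<sigma> v" and g = "\<lambda>\<sigma>. inv \<sigma> w"])
       (auto simp only: set eq UNIV_I intro!: meas AB)
qed

text \<open>Given the positions of the values up to \<open>x\<close>, the ranks of these values (0 for \<open>x\<close>, 1 for
  \<open>x - 1\<close>, and so on) follow a Mallows law on a half-line that depends neither on \<open>x\<close> nor on \<open>S\<close>.
  Only its marginals on the finitely many rightmost positions are needed.  Reading from right to
  left, each rank is geometric on the ranks not yet used, which determines \<open>c\<close>.  The comparison
  of two levels rests on \<open>c\<close> being the same for both.\<close>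

lemma prob_labels:
  fixes T :: "int set" and r :: "int \<Rightarrow> nat"
  assumes "finite T"
  shows "\<exists>c. \<forall>x S. T \<subseteq> S \<longrightarrow> (\<forall>s\<in>S - T. \<forall>t\<in>T. s < t) \<longrightarrow>
    \<P>(\<sigma> in M. level x \<sigma> = S \<and> (\<forall>t\<in>T. \<sigma> t = x - int (r t))) = c * \<P>(\<sigma> in M. level x \<sigma> = S)"
  using assms
proof (induction T rule: finite_linorder_min_induct)
  case empty
  show ?case by (rule exI[of _ 1]) simp
next
  case (insert t T)
  obtain c where c: "\<And>x S. T \<subseteq> S \<Longrightarrow> \<forall>s\<in>S - T. \<forall>t\<in>T. s < t \<Longrightarrow>
    \<P>(\<sigma> in M. level x \<sigma> = S \<and> (\<forall>t\<in>T. \<sigma> t = x - int (r t))) = c * \<P>(\<sigma> in M. level x \<sigma> = S)"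
    using insert.IH by auto
  show ?case
  proof (cases "r t \<in> r ` T")
    case True
    then obtain u where u: "u \<in> T" "r u = r t" by auto
    have "\<P>(\<sigma> in M. level x \<sigma> = S \<and> (\<forall>t\<in>insert t T. \<sigma> t = x - int (r t))) = 0" for x S
    proof -
      have "{\<sigma> \<in> space M. level x \<sigma> = S \<and> (\<forall>t\<in>insert t T. \<sigma> t = x - int (r t))} = {}"
      proof (safe, goal_cases)
        case (1 \<sigma>)
        then have "\<sigma> u = \<sigma> t" using u by auto
        moreover have "inj \<sigma>" using 1 by (simp add: bij_is_inj)
        ultimately have "u = t" by (metis injD)
        then show ?case using insert.hyps u by auto
      qed
      then show ?thesis by (simp only: measure_empty)
    qed
    then show ?thesis by (intro exI[of _ 0]) simp
  next
    case False
    let ?N = "- r ` T"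
    have fin: "finite T" by fact
    have "\<P>(\<sigma> in M. level x \<sigma> = S \<and> (\<forall>t\<in>insert t T. \<sigma> t = x - int (r t))) =
        (1 - q) * q ^ card (?N \<inter> {..<r t}) * (c * \<P>(\<sigma> in M. level x \<sigma> = S))"
      if S: "insert t T \<subseteq> S" and top: "\<forall>s\<in>S - insert t T. \<forall>t\<in>insert t T. s < t" for x S
    proof -
      define lab where "lab \<sigma> \<longleftrightarrow> bij \<sigma> \<and> level x \<sigma> = S \<and> (\<forall>t\<in>T. \<sigma> t = x - int (r t))" for \<sigma>
      have [measurable]: "Measurable.pred M lab" unfolding lab_def using fin by measurable
      let ?A = "\<lambda>n. {\<sigma> \<in> space M. lab \<sigma> \<and> \<sigma> t = x - int n}"
      have t: "t \<notin> T" "t \<in> S" using insert.hyps S by auto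
      have lab_S: "j \<in> S \<longleftrightarrow> \<sigma> j \<le> x" if "lab \<sigma>" for \<sigma> j
        using that by (auto simp: lab_def level_def)
      have lab_T: "\<sigma> j = x - int n \<longrightarrow> j \<notin> T" if "lab \<sigma>" "n \<in> ?N" for \<sigma> j n
        using that by (auto simp: lab_def)
      have "prob (?A (r t)) = (1 - q) * q ^ card (?N \<inter> {..<r t}) * prob (\<Union>n\<in>?N. ?A n)"
      proof (rule prob_geometric_partition)
        show "infinite ?N" 
          using fin by (simp add: Compl_eq_Diff_UNIV Diff_infinite_finite)
        show "?A n \<in> sets M" for n by measurable
        show "disjoint_family_on ?A ?N" by (auto simp: disjoint_family_on_def)
        fix n n' assume n: "n \<in> ?N" "n' \<in> ?N" "n < n'" "?N \<inter> {n<..<n'} = {}"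
        \<comment> \<open>On \<open>?A n'\<close> the larger value \<open>x - int n\<close> is somewhere to the left of \<open>t\<close>; exchanging it with
          the value at \<open>t\<close> leads from \<open>?A n\<close> to \<open>?A n'\<close> and creates one inversion.\<close>
        show "prob (?A n') = q * prob (?A n)"
        proof (rule prob_scale_by_position[where v = "x - int n" and w = "x - int n'"])
          fix p
          show "\<P>(\<sigma> in M. (lab \<sigma> \<and> \<sigma> t = x - int n') \<and> \<sigma> p = x - int n) =
             q * \<P>(\<sigma> in M. (lab \<sigma> \<and> \<sigma> t = x - int n) \<and> \<sigma> p = x - int n')"
          proof (cases "p \<in> S \<and> p < t")
            case True
            let ?Q = "\<lambda>\<sigma>. (lab \<sigma> \<and> \<sigma> t = x - int n) \<and> \<sigma> p = x - int n'"
            have pT: "p \<notin> T" using True insert.hyps by auto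
            have "\<P>(\<sigma> in M. ?Q (\<sigma> \<circ> swap p t)) = q * \<P>(\<sigma> in M. ?Q \<sigma>)"
            proof (rule prob_swap)
              show "p < t" using True by simp
              fix \<sigma> assume Q: "?Q \<sigma>"
              then show "\<sigma> p < \<sigma> t" using n by simp
              show "\<sigma> j < \<sigma> p \<or> \<sigma> t < \<sigma> j" if j: "p < j" "j < t" for j
              proof (rule ccontr)
                assume "\<not> (\<sigma> j < \<sigma> p \<or> \<sigma> t < \<sigma> j)"
                moreover have inj: "inj \<sigma>" using Q by (simp add: lab_def bij_is_inj)
                have "\<sigma> j \<noteq> \<sigma> p" "\<sigma> j \<noteq> \<sigma> t"
                  using j inj by (metis injD less_irrefl)+
                ultimately have between: "x - int n' < \<sigma> j" "\<sigma> j < x - int n" using Q by auto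
                define m where "m = nat (x - \<sigma> j)"
                have m: "\<sigma> j = x - int m" "n < m" "m < n'" using between by (auto simp: m_def)
                then have "m \<notin> ?N" using n(4) by auto
                then obtain u where u: "u \<in> T" "m = r u" by auto
                then have "\<sigma> u = \<sigma> j" using Q m by (auto simp: lab_def)
                with inj have "u = j" by (rule injD)
                then show False using u j insert.hyps by auto
              qed
            qed measurable
            moreover have "lab (\<sigma> \<circ> swap p t) \<longleftrightarrow> lab \<sigma>" for \<sigma>
            proof -
              have "swap p t u = u" if "u \<in> T" for u
                using that pT t by (metis transpose_apply_other)
              then show ?thesis using True t by (simp add: lab_def level_comp_swap)
            qed
            ultimately show ?thesis using True by (simp add: conj_ac)
          next
            case False
            have no: "\<not> (lab \<sigma> \<and> \<sigma> t = x - int m \<and> \<sigma> p = x - int m')"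
              if "m \<in> ?N" "m' \<in> ?N" "m \<noteq> m'" for \<sigma> m m'
            proof
              assume a: "lab \<sigma> \<and> \<sigma> t = x - int m \<and> \<sigma> p = x - int m'"
              then have "p \<in> S" using lab_S[of \<sigma> p] by simp
              moreover have "p \<notin> T" using lab_T a that by blast
              moreover have "p \<noteq> t" using a that by auto
              ultimately have "p < t" using top by auto
              then show False using False \<open>p \<in> S\<close> by simp
            qed
            have "{\<sigma> \<in> space M. (lab \<sigma> \<and> \<sigma> t = x - int n') \<and> \<sigma> p = x - int n} = {}"
              using no[of n' n] n by blast
            moreover have "{\<sigma> \<in> space M. (lab \<sigma> \<and> \<sigma> t = x - int n) \<and> \<sigma> p = x - int n'} = {}"
              using no[of n n'] n by blast
            ultimately show ?thesis by (simp only: measure_empty mult_zero_right)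
          qed
        qed (use q_pos in auto)
      qed (use q_pos q_less_1 False in auto)
      also have "(\<Union>n\<in>?N. ?A n) = {\<sigma> \<in> space M. lab \<sigma>}"
      proof (intro set_eqI iffI)
        fix \<sigma> assume a: "\<sigma> \<in> {\<sigma> \<in> space M. lab \<sigma>}"
        define n where "n = nat (x - \<sigma> t)"
        have n: "\<sigma> t = x - int n" using lab_S[of \<sigma> t] a t by (auto simp: n_def)
        have "n \<in> ?N"
        proof (rule ComplI)
          assume "n \<in> r ` T"
          then obtain u where u: "u \<in> T" "n = r u" by auto
          then have "\<sigma> u = \<sigma> t" using a n by (auto simp: lab_def)
          moreover have "inj \<sigma>" using a by (simp add: bij_is_inj)
          ultimately have "u = t" by (metis injD)
          then show False using u t by simp
        qed
        then show "\<sigma> \<in> (\<Union>n\<in>?N. ?A n)" using a n by blast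
      qed auto
      also have "\<P>(\<sigma> in M. lab \<sigma>) = c * \<P>(\<sigma> in M. level x \<sigma> = S)"
      proof -
        have "\<forall>s\<in>S - T. \<forall>t\<in>T. s < t" using top insert.hyps by auto
        from c[OF _ this] S show ?thesis by (simp add: lab_def)
      qed
      also have "?A (r t) = {\<sigma> \<in> space M. level x \<sigma> = S \<and> (\<forall>t\<in>insert t T. \<sigma> t = x - int (r t))}"
        by (auto simp: lab_def)
      finally show ?thesis .
    qed
    then show ?thesis
      by (intro exI[of _ "(1 - q) * q ^ card (?N \<inter> {..<r t}) * c"]) simp
  qed
qed

end

section \<open>Comparing two adjacent levels under the balanced measure\<close>

locale balanced_mallows = q_exchangeable_permutation +
  assumes AE_balanced: "AE \<sigma> in M. balanced \<sigma>"
begin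

lemma AE_level_has_charge: "AE \<sigma> in M. \<forall>x i. has_charge i (level x \<sigma>) (x - i)"
  using AE_balanced AE_space by eventually_elim (simp add: balanced_has_charge)

text \<open>The two exponents in the ratio of the level set probabilities differ by the charge of \<open>S\<close>
  about \<open>i\<close>, up to the gap at \<open>i\<close> itself, and thus by \<open>x - i\<close>.  The law of the ranks contributes
  the same factor on both sides.\<close>

lemma prob_level_labels_insert:
  assumes i: "i \<notin> S" and S: "has_charge i S (x - 1 - i)" and T: "T = S \<inter> {i<..}"
  shows "\<P>(\<sigma> in M. level (x - 1) \<sigma> = S \<and> (\<forall>t\<in>T. \<sigma> t = x - 1 - int (r t))) =
    q powi (x - i) * \<P>(\<sigma> in M. level x \<sigma> = insert i S \<and> (\<forall>t\<in>T. \<sigma> t = x - int (r t)))"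
proof -
  have fin: "finite T" "finite ({..<i} - S)"
    using S by (auto simp: has_charge_def T intro: finite_subset[of _ "{..i} - S"])
  have "{..i} - S = insert i ({..<i} - S)" using i by auto
  then have card: "int (card T) - int (card ({..<i} - S)) = x - i"
    using S fin by (simp add: has_charge_def T)
  have q0: "q \<noteq> 0" using q_pos by simp
  have lev: "\<P>(\<sigma> in M. level (x - 1) \<sigma> = S) = q powi (x - i) * \<P>(\<sigma> in M. level x \<sigma> = insert i S)"
    using prob_level_insert[OF i, of x] fin q0 unfolding card[symmetric] T
    by (simp add: power_int_diff field_simps)
  obtain c where c: "\<And>x S. T \<subseteq> S \<Longrightarrow> \<forall>s\<in>S - T. \<forall>t\<in>T. s < t \<Longrightarrow>
    \<P>(\<sigma> in M. level x \<sigma> = S \<and> (\<forall>t\<in>T. \<sigma> t = x - int (r t))) = c * \<P>(\<sigma> in M. level x \<sigma> = S)"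
    using prob_labels[OF fin(1), of r] by blast
  have "\<P>(\<sigma> in M. level (x - 1) \<sigma> = S \<and> (\<forall>t\<in>T. \<sigma> t = x - 1 - int (r t))) = c * \<P>(\<sigma> in M. level (x - 1) \<sigma> = S)"
    by (rule c) (auto simp: T)
  moreover have "\<P>(\<sigma> in M. level x \<sigma> = insert i S \<and> (\<forall>t\<in>T. \<sigma> t = x - int (r t))) = c * \<P>(\<sigma> in M. level x \<sigma> = insert i S)"
    by (rule c) (auto simp: T)
  ultimately show ?thesis using lev by simp
qed

text \<open>The cells are indexed by the level set without \<open>i\<close> and the ranks on its finite part to the
  right of \<open>i\<close>; being balanced makes the set of cells countable.  A condition \<open>\<sigma> (p j) < y j\<close> at
  level \<open>x - 1\<close> and \<open>\<sigma> (p j) \<le> y j\<close> at level \<open>x\<close> are the same condition on the cell: \<open>p j\<close> is in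
  the level set and its rank is at least \<open>x - y j\<close>.\<close>

theorem prob_raise_level:
  fixes p y :: "'j \<Rightarrow> int"
  assumes J: "finite J" and p: "\<And>j. j \<in> J \<Longrightarrow> i < p j" and y: "\<And>j. j \<in> J \<Longrightarrow> y j \<le> x"
  shows "\<P>(\<sigma> in M. x \<le> \<sigma> i \<and> (\<forall>j\<in>J. \<sigma> (p j) < y j)) =
    q powi (x - i) * \<P>(\<sigma> in M. \<sigma> i \<le> x \<and> (\<forall>j\<in>J. \<sigma> (p j) \<le> y j))"
    (is "\<P>(\<sigma> in M. ?A \<sigma>) = _ * \<P>(\<sigma> in M. ?B \<sigma>)")
proof -
  let ?T = "\<lambda>S. S \<inter> {i<..}"
  define labels where "labels z \<sigma> = restrict (\<lambda>t. nat (z - \<sigma> t)) (?T (level z \<sigma>))" for z :: int and \<sigma> :: "int \<Rightarrow> int"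
  define I where "I = (SIGMA S:{S. i \<notin> S \<and> has_charge i S (x - 1 - i)}. ?T S \<rightarrow>\<^sub>E (UNIV :: nat set))"
  let ?f = "\<lambda>\<sigma>. (level (x - 1) \<sigma>, labels (x - 1) \<sigma>)"
  let ?g = "\<lambda>\<sigma>. (level x \<sigma> - {i}, labels x \<sigma>)"
  have labels: "labels z \<sigma> = r \<longleftrightarrow> (\<forall>t\<in>?T S. \<sigma> t = z - int (r t))"
    if lev: "level z \<sigma> = S" and r: "r \<in> ?T S \<rightarrow>\<^sub>E UNIV" for z \<sigma> r S
  proof
    assume "labels z \<sigma> = r"
    then have "r t = nat (z - \<sigma> t)" if "t \<in> ?T S" for t
      using that lev by (auto simp: labels_def restrict_def)
    then show "\<forall>t\<in>?T S. \<sigma> t = z - int (r t)" using lev by (auto simp: level_def)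
  next
    assume "\<forall>t\<in>?T S. \<sigma> t = z - int (r t)"
    then show "labels z \<sigma> = r"
      using r lev by (auto simp: labels_def restrict_def PiE_def extensional_def fun_eq_iff)
  qed
  have T_insert: "?T (insert i S) = ?T S" for S by auto
  have labels_del: "labels z \<sigma> = r \<longleftrightarrow> (\<forall>t\<in>?T S. \<sigma> t = z - int (r t))"
    if "level z \<sigma> = insert i S" and "r \<in> ?T S \<rightarrow>\<^sub>E UNIV" for z \<sigma> r S
    using labels[OF that(1), of r] that(2) by (simp add: T_insert)
  define ok where "ok S r \<longleftrightarrow> (\<forall>j\<in>J. p j \<in> S \<and> x - y j \<le> int (r (p j)))" for S and r :: "int \<Rightarrow> nat"
  let ?A' = "\<lambda>S r \<sigma>. ok S r \<and> level (x - 1) \<sigma> = S \<and> (\<forall>t\<in>?T S. \<sigma> t = x - 1 - int (r t))"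
  let ?B' = "\<lambda>S r \<sigma>. ok S r \<and> level x \<sigma> = insert i S \<and> (\<forall>t\<in>?T S. \<sigma> t = x - int (r t))"
  have A: "?A \<sigma> \<and> ?f \<sigma> = (S, r) \<longleftrightarrow> ?A' S r \<sigma>" if "(S, r) \<in> I" for S r \<sigma>
  proof (cases "level (x - 1) \<sigma> = S")
    case True
    then have S: "j \<in> S \<longleftrightarrow> \<sigma> j \<le> x - 1" for j by (auto simp: level_def)
    have iS: "i \<notin> S" using that by (simp add: I_def)
    have "?A \<sigma> \<longleftrightarrow> ok S r" if lab: "\<forall>t\<in>?T S. \<sigma> t = x - 1 - int (r t)"
    proof -
      have "\<sigma> (p j) < y j \<longleftrightarrow> p j \<in> S \<and> x - y j \<le> int (r (p j))" if j: "j \<in> J" for j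
        using lab[rule_format, of "p j"] S[of "p j"] y[OF j] p[OF j] by auto
      then show ?thesis using iS S[of i] by (auto simp: ok_def)
    qed
    then show ?thesis using labels[OF True, of r] that True by (auto simp: I_def)
  qed auto
  have B: "?B \<sigma> \<and> ?g \<sigma> = (S, r) \<longleftrightarrow> ?B' S r \<sigma>" if "(S, r) \<in> I" for S r \<sigma>
  proof (cases "level x \<sigma> = insert i S")
    case True
    then have S: "j \<in> insert i S \<longleftrightarrow> \<sigma> j \<le> x" for j by (auto simp: level_def)
    have iS: "i \<notin> S" using that by (simp add: I_def)
    have "?B \<sigma> \<longleftrightarrow> ok S r" if lab: "\<forall>t\<in>?T S. \<sigma> t = x - int (r t)"
    proof -
      have "\<sigma> (p j) \<le> y j \<longleftrightarrow> p j \<in> S \<and> x - y j \<le> int (r (p j))" if j: "j \<in> J" for j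
        using lab[rule_format, of "p j"] S[of "p j"] y[OF j] p[OF j] by auto
      then show ?thesis using S[of i] by (auto simp: ok_def)
    qed
    moreover have "level x \<sigma> - {i} = S" using True iS by auto
    ultimately show ?thesis using labels_del[OF True, of r] that True by (auto simp: I_def)
  next
    case False
    then show ?thesis using that by (auto simp: I_def level_def)
  qed
  have [measurable]: "Measurable.pred M ?A" "Measurable.pred M ?B"
    using J by measurable
  have meas': "Measurable.pred M (?A' S r)" "Measurable.pred M (?B' S r)" if "(S, r) \<in> I" for S r
  proof -
    have [measurable]: "finite (?T S)" using that by (simp add: I_def has_charge_def)
    show "Measurable.pred M (?A' S r)" "Measurable.pred M (?B' S r)" by measurable
  qed
  show ?thesis
  proof (rule prob_scale_by_partition[where I = I and f = ?f and g = ?g])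
    show "countable I"
      unfolding I_def
    proof (rule countable_SIGMA)
      show "countable {S. i \<notin> S \<and> has_charge i S (x - 1 - i)}"
        by (rule countable_subset[OF _ countable_has_charge]) auto
      show "countable (?T S \<rightarrow>\<^sub>E (UNIV :: nat set))" if "S \<in> {S. i \<notin> S \<and> has_charge i S (x - 1 - i)}" for S
        using that by (intro countable_PiE) (auto simp: has_charge_def)
    qed
    show "AE \<sigma> in M. ?A \<sigma> \<longrightarrow> ?f \<sigma> \<in> I"
      using AE_level_has_charge
    proof eventually_elim
      case (elim \<sigma>)
      have "i \<notin> level (x - 1) \<sigma>" if "x \<le> \<sigma> i" using that by (simp add: level_def)
      then show ?case using elim by (auto simp: I_def labels_def)
    qed
    show "AE \<sigma> in M. ?B \<sigma> \<longrightarrow> ?g \<sigma> \<in> I"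
      using AE_level_has_charge
    proof eventually_elim
      case (elim \<sigma>)
      show ?case
      proof
        assume "?B \<sigma>"
        then have "insert i (level x \<sigma> - {i}) = level x \<sigma>" by (auto simp: level_def)
        then have "has_charge i (level x \<sigma> - {i}) (x - 1 - i)"
          using elim has_charge_insert[of i "level x \<sigma> - {i}" i "x - 1 - i"] by simp
        moreover have "?T (level x \<sigma> - {i}) = ?T (level x \<sigma>)" by auto
        ultimately show "?g \<sigma> \<in> I" by (simp add: I_def labels_def)
      qed
    qed
    fix u assume u: "u \<in> I"
    obtain S r where Sr: "u = (S, r)" by (cases u)
    note I = u[unfolded Sr]
    show "Measurable.pred M (\<lambda>\<sigma>. ?A \<sigma> \<and> ?f \<sigma> = u)" "Measurable.pred M (\<lambda>\<sigma>. ?B \<sigma> \<and> ?g \<sigma> = u)"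
      unfolding Sr A[OF I] B[OF I] by (rule meas'[OF I])+
    show "\<P>(\<sigma> in M. ?A \<sigma> \<and> ?f \<sigma> = u) = q powi (x - i) * \<P>(\<sigma> in M. ?B \<sigma> \<and> ?g \<sigma> = u)"
      unfolding Sr A[OF I] B[OF I]
      using prob_level_labels_insert[of i S x "?T S" r] I by (cases "ok S r") (auto simp: I_def)
  qed (use q_pos in auto)
qed

end

section \<open>The Jacobi triple product\<close>

text \<open>This is the finite \<open>q\<close>-Pochhammer symbol \<open>(q; q)\<^sub>n\<close>; the powers of \<open>1 - q\<close> by which it differs
  from the usual \<open>q\<close>-factorial cancel in the Gaussian binomial coefficients.\<close>

definition q_fact :: "real \<Rightarrow> nat \<Rightarrow> real" where
  "q_fact q n = (\<Prod>k<n. 1 - q ^ (k + 1))"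

definition q_binomial :: "real \<Rightarrow> nat \<Rightarrow> nat \<Rightarrow> real" where
  "q_binomial q n k = (if k \<le> n then q_fact q n / (q_fact q k * q_fact q (n - k)) else 0)"

lemma q_fact_0 [simp]: "q_fact q 0 = 1"
  by (simp add: q_fact_def)

lemma q_fact_Suc: "q_fact q (Suc n) = q_fact q n * (1 - q ^ (n + 1))"
  by (simp add: q_fact_def)

context
  fixes q :: real
  assumes q: "0 < q" "q < 1"
begin

lemma one_minus_power_pos: "0 < 1 - q ^ (k + 1)"
  using q power_Suc_less_one[of q k] by simp

lemma q_fact_pos: "0 < q_fact q n"
  unfolding q_fact_def using one_minus_power_pos by (intro prod_pos) auto

lemma q_binomial_Suc_Suc:
  "q_binomial q (Suc n) (Suc k) = q_binomial q n (Suc k) + q ^ (n - k) * q_binomial q n k"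
proof -
  consider "k < n" | "k = n" | "k > n" by linarith
  then show ?thesis
  proof cases
    case 1
    define m where "m = n - Suc k"
    have n: "n = k + Suc m" using 1 by (simp add: m_def)
    have nz: "q_fact q k \<noteq> 0" "q_fact q m \<noteq> 0" "1 - q ^ (k + 1) \<noteq> 0" "1 - q ^ (m + 1) \<noteq> 0"
      using q_fact_pos[of k] q_fact_pos[of m] one_minus_power_pos[of k] one_minus_power_pos[of m] by auto
    have "1 - q ^ (n + 1) = (1 - q ^ (m + 1)) + q ^ (m + 1) * (1 - q ^ (k + 1))"
      by (simp add: n algebra_simps power_add)
    then have "q_binomial q (Suc n) (Suc k) = q_fact q n * ((1 - q ^ (m + 1)) + q ^ (m + 1) * (1 - q ^ (k + 1))) /
        ((q_fact q k * (1 - q ^ (k + 1))) * (q_fact q m * (1 - q ^ (m + 1))))"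
      by (simp add: q_binomial_def q_fact_Suc n)
    also have "\<dots> = q_fact q n / ((q_fact q k * (1 - q ^ (k + 1))) * q_fact q m) +
        q ^ (m + 1) * (q_fact q n / (q_fact q k * (q_fact q m * (1 - q ^ (m + 1)))))"
      using nz by (simp add: divide_simps del: power_Suc) (simp add: algebra_simps del: power_Suc)
    finally show ?thesis by (simp add: q_binomial_def q_fact_Suc n)
  next
    case 2
    then show ?thesis using q_fact_pos[of n] q_fact_pos[of "Suc n"] by (simp add: q_binomial_def)
  qed (simp add: q_binomial_def)
qed

text \<open>Cauchy's \<open>q\<close>-analogue of the binomial theorem, by induction with the \<open>q\<close>-Pascal rule.\<close>

lemma q_binomial_theorem:
  "(\<Prod>k<n. 1 + z * q ^ k) = (\<Sum>k\<le>n. q_binomial q n k * q ^ (k choose 2) * z ^ k)"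
proof (induction n)
  case 0
  then show ?case by (simp add: q_binomial_def numeral_2_eq_2)
next
  case (Suc n)
  let ?f = "\<lambda>n k. q_binomial q n k * q ^ (k choose 2) * z ^ k"
  have 0: "?f (Suc n) 0 = ?f n 0"
    using q_fact_pos[of n] q_fact_pos[of "Suc n"] by (simp add: q_binomial_def)
  have Suc_k: "?f (Suc n) (Suc k) = ?f n (Suc k) + z * q ^ n * ?f n k" if "k \<le> n" for k
  proof -
    have "q ^ (n - k) * q ^ (Suc k choose 2) = q ^ n * q ^ (k choose 2)"
      using that by (simp add: numeral_2_eq_2 flip: power_add)
    then show ?thesis by (simp add: q_binomial_Suc_Suc algebra_simps)
  qed
  have "(\<Sum>k\<le>Suc n. ?f (Suc n) k) = ?f (Suc n) 0 + (\<Sum>k\<le>n. ?f (Suc n) (Suc k))"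
    by (rule sum.atMost_Suc_shift)
  also have "(\<Sum>k\<le>n. ?f (Suc n) (Suc k)) = (\<Sum>k\<le>n. ?f n (Suc k)) + z * q ^ n * (\<Sum>k\<le>n. ?f n k)"
    unfolding sum_distrib_left sum.distrib[symmetric] by (rule sum.cong) (use Suc_k in auto)
  also have "?f (Suc n) 0 + ((\<Sum>k\<le>n. ?f n (Suc k)) + z * q ^ n * (\<Sum>k\<le>n. ?f n k)) =
      (\<Sum>k\<le>Suc n. ?f n k) + z * q ^ n * (\<Sum>k\<le>n. ?f n k)"
    unfolding 0 by (subst sum.atMost_Suc_shift) simp
  also have "(\<Sum>k\<le>Suc n. ?f n k) = (\<Sum>k\<le>n. ?f n k)"
    by (simp add: q_binomial_def)
  finally show ?case using Suc by (simp add: algebra_simps)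
qed

lemma power_choose_two: "q ^ (k choose 2) = q powr (real k * (real k - 1) / 2)"
proof (induction k)
  case (Suc k)
  have "q ^ (Suc k choose 2) = q powr real k * q powr (real k * (real k - 1) / 2)"
    using q Suc by (simp add: numeral_2_eq_2 power_add powr_realpow)
  also have "\<dots> = q powr (real (Suc k) * (real (Suc k) - 1) / 2)"
    unfolding powr_add[symmetric] by (simp add: field_simps)
  finally show ?case .
qed (use q in \<open>simp add: numeral_2_eq_2\<close>)

text \<open>Substituting \<open>2 n\<close> for \<open>n\<close> and \<open>z = \<alpha> q\<^bsup>1/2 - n\<^esup>\<close> in the \<open>q\<close>-binomial theorem centres the
  exponents: the upper half of the factors is the first product, and the lower half is the second
  one after \<open>\<alpha> q\<^bsup>- k - 1/2\<^esup>\<close> is pulled out of each factor.\<close>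

lemma finite_jacobi_triple_product:
  assumes \<alpha>: "0 < \<alpha>"
  shows "(\<Prod>k<n. 1 + \<alpha> * q powr (real k + 1 / 2)) * (\<Prod>k<n. 1 + inverse \<alpha> * q powr (real k + 1 / 2)) =
    (\<Sum>c = - int n..int n. q_binomial q (2 * n) (nat (int n + c)) * (\<alpha> powi c * q powr ((real_of_int c)\<^sup>2 / 2)))"
proof -
  define z where "z = \<alpha> * q powr (1 / 2 - real n)"
  let ?g = "\<lambda>k. 1 + z * q ^ k"
  have zq: "z * q ^ k = \<alpha> * q powr (real k - real n + 1 / 2)" for k
    using q by (simp add: z_def powr_realpow[symmetric] powr_add[symmetric] algebra_simps)
  have split: "prod ?g {..<n + m} = prod ?g {..<n} * (\<Prod>k<m. ?g (n + k))" for m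
    by (induction m) auto
  have low: "prod ?g {..<n} = \<alpha> ^ n * q powr (- (real n)\<^sup>2 / 2) * (\<Prod>k<n. 1 + inverse \<alpha> * q powr (real k + 1 / 2))"
  proof -
    have "prod ?g {..<n} = (\<Prod>k<n. ?g (n - Suc k))" by (rule prod.nat_diff_reindex[symmetric])
    also have "\<dots> = (\<Prod>k<n. \<alpha> * q powr (- real k - 1 / 2) * (1 + inverse \<alpha> * q powr (real k + 1 / 2)))"
    proof (rule prod.cong)
      fix k assume "k \<in> {..<n}"
      then have "real (n - Suc k) - real n + 1 / 2 = - real k - 1 / 2" by (simp add: of_nat_diff)
      then have "z * q ^ (n - Suc k) = \<alpha> * q powr (- real k - 1 / 2)" by (simp only: zq)
      moreover have "q powr (- real k - 1 / 2) * q powr (real k + 1 / 2) = 1"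
        unfolding powr_add[symmetric] using q by simp
      ultimately show "?g (n - Suc k) = \<alpha> * q powr (- real k - 1 / 2) * (1 + inverse \<alpha> * q powr (real k + 1 / 2))"
        using \<alpha> by (simp add: field_simps)
    qed simp
    also have "\<dots> = (\<Prod>k<n. \<alpha> * q powr (- real k - 1 / 2)) * (\<Prod>k<n. 1 + inverse \<alpha> * q powr (real k + 1 / 2))"
      by (rule prod.distrib)
    also have "(\<Prod>k<n. \<alpha> * q powr (- real k - 1 / 2)) = \<alpha> ^ n * q powr (- (real n)\<^sup>2 / 2)"
    proof (induction n)
      case (Suc n)
      have "- (real n)\<^sup>2 / 2 + (- real n - 1 / 2) = - (real (Suc n))\<^sup>2 / 2"
        by (simp add: power2_eq_square field_simps)
      then have "q powr (- (real n)\<^sup>2 / 2) * q powr (- real n - 1 / 2) = q powr (- (real (Suc n))\<^sup>2 / 2)"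
        by (simp only: powr_add[symmetric])
      then show ?case using Suc by (simp add: algebra_simps)
    qed (use q in simp)
    finally show ?thesis .
  qed
  have high: "(\<Prod>k<n. ?g (n + k)) = (\<Prod>k<n. 1 + \<alpha> * q powr (real k + 1 / 2))"
    unfolding zq by simp
  have summand: "q ^ (k choose 2) * z ^ k =
      (\<alpha> ^ n * q powr (- (real n)\<^sup>2 / 2)) * (\<alpha> powi (int k - int n) * q powr ((real k - real n)\<^sup>2 / 2))" for k
  proof -
    have "z ^ k = \<alpha> ^ k * q powr (real k * (1 / 2 - real n))"
      using q by (simp add: z_def power_mult_distrib powr_power algebra_simps)
    moreover have "\<alpha> ^ k = \<alpha> ^ n * \<alpha> powi (int k - int n)"
      using \<alpha> by (simp add: power_int_diff)
    moreover have "real k * (real k - 1) / 2 + real k * (1 / 2 - real n) = - (real n)\<^sup>2 / 2 + (real k - real n)\<^sup>2 / 2"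
      by (simp add: power2_eq_square field_simps)
    then have "q powr (real k * (real k - 1) / 2) * q powr (real k * (1 / 2 - real n)) =
        q powr (- (real n)\<^sup>2 / 2) * q powr ((real k - real n)\<^sup>2 / 2)"
      by (simp only: powr_add[symmetric])
    ultimately show ?thesis unfolding power_choose_two by (simp add: mult_ac)
  qed
  let ?C = "\<alpha> ^ n * q powr (- (real n)\<^sup>2 / 2)"
  have "?C * ((\<Prod>k<n. 1 + \<alpha> * q powr (real k + 1 / 2)) * (\<Prod>k<n. 1 + inverse \<alpha> * q powr (real k + 1 / 2))) =
      prod ?g {..<2 * n}"
  proof -
    have "prod ?g {..<2 * n} = prod ?g {..<n} * (\<Prod>k<n. ?g (n + k))"
      using split[of n] unfolding mult_2 .
    then show ?thesis unfolding low high by (simp only: mult_ac)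
  qed
  also have "\<dots> = (\<Sum>k\<le>2 * n. q_binomial q (2 * n) k * (q ^ (k choose 2) * z ^ k))"
    unfolding q_binomial_theorem by (simp add: mult.assoc)
  also have "\<dots> = ?C * (\<Sum>k\<le>2 * n. q_binomial q (2 * n) k * (\<alpha> powi (int k - int n) * q powr ((real k - real n)\<^sup>2 / 2)))"
    unfolding summand sum_distrib_left by (simp add: mult_ac)
  also have "(\<Sum>k\<le>2 * n. q_binomial q (2 * n) k * (\<alpha> powi (int k - int n) * q powr ((real k - real n)\<^sup>2 / 2))) =
    (\<Sum>c = - int n..int n. q_binomial q (2 * n) (nat (int n + c)) * (\<alpha> powi c * q powr ((real_of_int c)\<^sup>2 / 2)))"
    by (rule sum.reindex_bij_witness[of _ "\<lambda>c. nat (int n + c)" "\<lambda>k. int k - int n"]) (auto simp: nat_le_iff)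
  finally show ?thesis using \<alpha> q by simp
qed

lemma convergent_prod_one_plus_powr:
  assumes \<beta>: "0 < \<beta>"
  shows "convergent_prod (\<lambda>k. 1 + \<beta> * q powr (real k + 1 / 2))"
proof (rule summable_imp_convergent_prod_real)
  have "(\<lambda>k. \<bar>\<beta> * q powr (real k + 1 / 2)\<bar>) = (\<lambda>k. \<bar>\<beta>\<bar> * q powr (1 / 2) * q ^ k)"
    using q by (auto simp: abs_mult powr_add powr_realpow fun_eq_iff)
  then show "summable (\<lambda>k. \<bar>\<beta> * q powr (real k + 1 / 2)\<bar>)"
    using q by (simp add: summable_mult summable_geometric)
  show "\<beta> * q powr (real k + 1 / 2) \<noteq> - 1" for k
    using mult_pos_pos[OF \<beta>, of "q powr (real k + 1 / 2)"] q by simp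
qed

lemma LIMSEQ_prodinf_lessThan:
  fixes f :: "nat \<Rightarrow> real"
  assumes "convergent_prod f" shows "(\<lambda>n. \<Prod>k<n. f k) \<longlonglongrightarrow> prodinf f"
  using convergent_prod_LIMSEQ[OF assms] by (simp add: LIMSEQ_lessThan_iff_atMost)

lemma q_fact_tendsto: "q_fact q \<longlonglongrightarrow> (\<Prod>k. 1 - q ^ (k + 1))" (is ?lim)
  and prodinf_one_minus_power_pos: "0 < (\<Prod>k. 1 - q ^ (k + 1))" (is ?pos)
proof -
  have "convergent_prod (\<lambda>k. 1 + - (q ^ (k + 1)))"
  proof (rule summable_imp_convergent_prod_real)
    show "summable (\<lambda>k. \<bar>- (q ^ (k + 1))\<bar>)"
      using q summable_geometric[of q] by (simp add: abs_mult power_abs summable_mult)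
    show "- (q ^ (k + 1)) \<noteq> - 1" for k
      using one_minus_power_pos[of k] by simp
  qed
  then have conv: "convergent_prod (\<lambda>k. 1 - q ^ (k + 1))" by simp
  from LIMSEQ_prodinf_lessThan[OF conv] show ?lim
    unfolding q_fact_def[abs_def] .
  have "(\<Prod>k. 1 - q ^ (k + 1)) \<noteq> 0"
    using conv one_minus_power_pos by (intro prodinf_nonzero) (auto simp: less_imp_neq[symmetric])
  moreover have "0 \<le> (\<Prod>k. 1 - q ^ (k + 1))"
    using \<open>?lim\<close> by (rule LIMSEQ_le_const) (use q_fact_pos in \<open>auto intro: less_imp_le\<close>)
  ultimately show ?pos by simp
qed

lemma prodinf_one_plus_powr_pos: 
  assumes "0 < \<beta>" shows "0 < (\<Prod>k. 1 + \<beta> * q powr (real k + 1 / 2))"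
proof -
  have "1 \<le> (\<Prod>k. 1 + \<beta> * q powr (real k + 1 / 2))"
    using LIMSEQ_prodinf_lessThan[OF convergent_prod_one_plus_powr[OF assms]]
    by (rule LIMSEQ_le_const) (use assms in \<open>auto intro!: prod_ge_1\<close>)
  then show ?thesis by simp
qed

lemma q_fact_ratio_mono:
  "q_fact q (a + b) / (q_fact q a * q_fact q b) \<le> q_fact q (Suc a + b) / (q_fact q (Suc a) * q_fact q b)"
proof -
  have "q ^ (a + b + 1) \<le> q ^ (a + 1)" using q by (intro power_decreasing) auto
  then have "1 \<le> (1 - q ^ (a + b + 1)) / (1 - q ^ (a + 1))"
    using one_minus_power_pos[of a] by simp
  then have "q_fact q (a + b) / (q_fact q a * q_fact q b) * 1 \<le>
    q_fact q (a + b) / (q_fact q a * q_fact q b) * ((1 - q ^ (a + b + 1)) / (1 - q ^ (a + 1)))"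
    using q_fact_pos by (intro mult_left_mono) (auto intro: less_imp_le)
  then show ?thesis by (simp add: q_fact_Suc mult_ac)
qed

text \<open>The central coefficients of the finite identity increase to \<open>1 / (q; q)\<^sub>\<infinity>\<close>, so the infinite
  identity follows by monotone convergence.\<close>

lemma jacobi_triple_product_nn_integral:
  assumes \<alpha>: "0 < \<alpha>"
  shows "(\<integral>\<^sup>+c. ennreal (mallows_weight q \<alpha> c) \<partial>count_space UNIV) = 1"
proof -
  define w where "w c = \<alpha> powi c * q powr ((real_of_int c)\<^sup>2 / 2)" for c :: int
  define b where "b n c = (if \<bar>c\<bar> \<le> int n then q_binomial q (2 * n) (nat (int n + c)) else 0)" for n :: nat and c :: int
  define L where "L = (\<Prod>k. 1 - q ^ (k + 1))"
  define A where "A = (\<Prod>k. 1 + \<alpha> * q powr (real k + 1 / 2))"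
  define B where "B = (\<Prod>k. 1 + inverse \<alpha> * q powr (real k + 1 / 2))"
  have pos: "0 < L" "0 < A" "0 < B" "0 < w c" for c
    using prodinf_one_minus_power_pos prodinf_one_plus_powr_pos[of \<alpha>] prodinf_one_plus_powr_pos[of "inverse \<alpha>"] \<alpha> q
    by (auto simp: L_def A_def B_def w_def)
  have b_eq: "b n c = q_fact q (nat (int n + c) + nat (int n - c)) / (q_fact q (nat (int n + c)) * q_fact q (nat (int n - c)))"
    if "\<bar>c\<bar> \<le> int n" for n c
  proof -
    have "2 * n = nat (int n + c) + nat (int n - c)" using that by simp
    then show ?thesis using that by (simp add: b_def q_binomial_def)
  qed
  have b_nonneg: "0 \<le> b n c" for n c
    using q_fact_pos by (auto simp: b_def q_binomial_def intro: less_imp_le)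
  have b_mono: "b n c \<le> b (Suc n) c" for n c
  proof (cases "\<bar>c\<bar> \<le> int n")
    case True
    let ?k = "nat (int n + c)" and ?l = "nat (int n - c)"
    have "nat (int (Suc n) + c) = Suc ?k" "nat (int (Suc n) - c) = Suc ?l" using True by auto
    moreover have "q_fact q (?k + ?l) / (q_fact q ?k * q_fact q ?l) \<le> q_fact q (Suc ?k + ?l) / (q_fact q (Suc ?k) * q_fact q ?l)"
      by (rule q_fact_ratio_mono)
    moreover have "\<dots> \<le> q_fact q (Suc ?k + Suc ?l) / (q_fact q (Suc ?k) * q_fact q (Suc ?l))"
      using q_fact_ratio_mono[of ?l "Suc ?k"] by (simp add: ac_simps)
    ultimately show ?thesis using True b_eq[of c n] b_eq[of c "Suc n"] by simp
  next
    case False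
    then have "b n c = 0" by (simp add: b_def)
    then show ?thesis using b_nonneg by simp
  qed
  have b_lim: "(\<lambda>n. b n c) \<longlonglongrightarrow> 1 / L" for c
  proof -
    have ev: "eventually (\<lambda>n. b n c = q_fact q (2 * n) / (q_fact q (nat (int n + c)) * q_fact q (nat (int n - c)))) sequentially"
      using eventually_ge_at_top[of "nat \<bar>c\<bar>"]
    proof eventually_elim
      case (elim n)
      then have "\<bar>c\<bar> \<le> int n" by simp
      moreover from this have "2 * n = nat (int n + c) + nat (int n - c)" by simp
      ultimately show ?case using b_eq[of c n] by simp
    qed
    have shift: "filterlim (\<lambda>n. nat (int n + d)) at_top sequentially" for d
      unfolding filterlim_at_top
    proof
      fix N show "eventually (\<lambda>n. N \<le> nat (int n + d)) sequentially"
        using eventually_ge_at_top[of "N + nat \<bar>d\<bar>"] by eventually_elim simp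
    qed
    have "filterlim (\<lambda>n::nat. 2 * n) at_top sequentially"
      unfolding filterlim_at_top
    proof
      fix N :: nat show "eventually (\<lambda>n. N \<le> 2 * n) sequentially"
        using eventually_ge_at_top[of N] by eventually_elim simp
    qed
    note lim = filterlim_compose[OF q_fact_tendsto this] filterlim_compose[OF q_fact_tendsto shift[of c]]
      filterlim_compose[OF q_fact_tendsto shift[of "- c"]]
    have "(\<lambda>n. q_fact q (2 * n) / (q_fact q (nat (int n + c)) * q_fact q (nat (int n - c)))) \<longlonglongrightarrow> L / (L * L)"
      using lim pos(1) unfolding L_def by (intro tendsto_divide tendsto_mult) auto
    then show ?thesis
      using pos(1) by (subst tendsto_cong[OF ev]) simp
  qed
  let ?F = "\<lambda>n. (\<Prod>k<n. 1 + \<alpha> * q powr (real k + 1 / 2)) * (\<Prod>k<n. 1 + inverse \<alpha> * q powr (real k + 1 / 2))"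
  have integral_b: "(\<integral>\<^sup>+c. ennreal (b n c * w c) \<partial>count_space UNIV) = ennreal (?F n)" for n
  proof -
    have "(\<integral>\<^sup>+c. ennreal (b n c * w c) \<partial>count_space UNIV) = (\<Sum>c\<in>{- int n..int n}. ennreal (b n c * w c))"
      by (rule nn_integral_count_space') (auto simp: b_def abs_le_iff)
    also have "\<dots> = ennreal (\<Sum>c = - int n..int n. b n c * w c)"
      using b_nonneg pos(4) by (intro sum_ennreal mult_nonneg_nonneg) (auto intro: less_imp_le)
    also have "(\<Sum>c = - int n..int n. b n c * w c) = ?F n"
      unfolding finite_jacobi_triple_product[OF \<alpha>] by (rule sum.cong) (auto simp: b_def w_def)
    finally show ?thesis .
  qed
  have "incseq (\<lambda>n c. ennreal (b n c * w c))"
    using b_mono pos(4) by (intro incseq_SucI le_funI ennreal_leI mult_right_mono) (auto intro: less_imp_le)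
  then have "(\<lambda>n. \<integral>\<^sup>+c. ennreal (b n c * w c) \<partial>count_space UNIV) \<longlonglongrightarrow>
      (\<integral>\<^sup>+c. (SUP n. ennreal (b n c * w c)) \<partial>count_space UNIV)"
    by (subst nn_integral_monotone_convergence_SUP) 
       (auto intro!: LIMSEQ_SUP incseq_SucI nn_integral_mono simp: incseq_def le_fun_def)
  moreover have "(SUP n. ennreal (b n c * w c)) = ennreal (1 / L * w c)" for c
  proof (rule LIMSEQ_unique)
    show "(\<lambda>n. ennreal (b n c * w c)) \<longlonglongrightarrow> (SUP n. ennreal (b n c * w c))"
      using b_mono[of _ c] pos(4)[of c]
      by (intro LIMSEQ_SUP incseq_SucI ennreal_leI mult_right_mono) (auto intro: less_imp_le)
    show "(\<lambda>n. ennreal (b n c * w c)) \<longlonglongrightarrow> ennreal (1 / L * w c)"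
      by (intro tendsto_ennrealI tendsto_mult b_lim tendsto_const)
  qed
  ultimately have "(\<lambda>n. ennreal (?F n)) \<longlonglongrightarrow> (\<integral>\<^sup>+c. ennreal (1 / L * w c) \<partial>count_space UNIV)"
    by (simp only: integral_b)
  moreover have "(\<lambda>n. ennreal (?F n)) \<longlonglongrightarrow> ennreal (A * B)"
    unfolding A_def B_def
    by (intro tendsto_ennrealI tendsto_mult LIMSEQ_prodinf_lessThan convergent_prod_one_plus_powr)
      (use \<alpha> in auto)
  ultimately have total: "(\<integral>\<^sup>+c. ennreal (1 / L * w c) \<partial>count_space UNIV) = ennreal (A * B)"
    by (rule LIMSEQ_unique)
  have "mallows_weight q \<alpha> c = 1 / (A * B) * (1 / L * w c)" for c
    by (simp add: mallows_weight_def w_def L_def A_def B_def)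
  then have "(\<integral>\<^sup>+c. ennreal (mallows_weight q \<alpha> c) \<partial>count_space UNIV) =
      (\<integral>\<^sup>+c. ennreal (1 / (A * B)) * ennreal (1 / L * w c) \<partial>count_space UNIV)"
    using pos by (intro nn_integral_cong) (simp add: ennreal_mult[symmetric] less_imp_le)
  also have "\<dots> = ennreal (1 / (A * B)) * ennreal (A * B)"
    unfolding total[symmetric] by (rule nn_integral_cmult) simp
  also have "\<dots> = 1"
    using pos by (simp add: ennreal_mult[symmetric] less_imp_le)
  finally show ?thesis .
qed

end

section \<open>The product measure\<close>

lemma mallows_weight_Suc:
  assumes "0 < q" "0 < \<alpha>"
  shows "mallows_weight q \<alpha> (c + 1) = \<alpha> * q powr (real_of_int c + 1 / 2) * mallows_weight q \<alpha> c"
proof -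
  have "(real_of_int (c + 1))\<^sup>2 / 2 = (real_of_int c + 1 / 2) + (real_of_int c)\<^sup>2 / 2"
    by (simp add: power2_eq_square field_simps)
  then have "q powr ((real_of_int (c + 1))\<^sup>2 / 2) = q powr (real_of_int c + 1 / 2) * q powr ((real_of_int c)\<^sup>2 / 2)"
    by (simp only: powr_add)
  moreover have "\<alpha> powi (c + 1) = \<alpha> * \<alpha> powi c"
    using assms by (simp add: power_int_add)
  ultimately show ?thesis by (simp add: mallows_weight_def)
qed

lemma mallows_weight_nonneg:
  assumes "0 < q" "q < 1" "0 < \<alpha>" shows "0 \<le> mallows_weight q \<alpha> c"
  using assms prodinf_one_minus_power_pos[OF assms(1,2)]
    prodinf_one_plus_powr_pos[OF assms(1,2), of \<alpha>] prodinf_one_plus_powr_pos[OF assms(1,2), of "inverse \<alpha>"]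
  unfolding mallows_weight_def by (intro divide_nonneg_pos mult_pos_pos mult_nonneg_nonneg) auto

context balanced_mallows
begin

lemma emeasure_mallows_product_event:
  assumes \<alpha>: "0 < \<alpha>" and Q: "Measurable.pred perm_space Q"
  shows "emeasure (mallows_product q \<alpha> M) {\<omega>. bij \<omega> \<and> Q \<omega>} =
    (\<integral>\<^sup>+c. ennreal (mallows_weight q \<alpha> c * \<P>(\<sigma> in M. Q (\<lambda>i. \<sigma> i + c))) \<partial>count_space UNIV)"
proof -
  have sets: "{\<omega>. bij \<omega> \<and> Q \<omega>} \<in> sets perm_space" using Q by (simp add: pred_def)
  have "bij (\<lambda>i. \<sigma> i + c)" if "bij \<sigma>" for \<sigma> :: "int \<Rightarrow> int" and c
    using measurable_space[OF measurable_shift_perm, of \<sigma> c] that by simp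
  then have "{\<sigma> \<in> space perm_space. (\<lambda>i. \<sigma> i + c) \<in> {\<omega>. bij \<omega> \<and> Q \<omega>}} = {\<sigma> \<in> space M. Q (\<lambda>i. \<sigma> i + c)}" for c
    by auto
  then show ?thesis
    unfolding emeasure_mallows_product[OF sets] emeasure_shifted_mallows[OF sets_M sets]
    using mallows_weight_nonneg[OF q_pos q_less_1 \<alpha>]
    by (intro nn_integral_cong) (simp add: emeasure_eq_measure ennreal_mult)
qed

text \<open>The part of the event with \<open>\<omega> i > x\<close> is compared with the part with \<open>\<omega> i \<le> x\<close>.  After the
  index of summation is shifted by one, the components match term by term: \<open>q\<^bsup>c + 1/2\<^esup>\<close> from the
  weights and \<open>q\<^bsup>x - c - i\<^esup>\<close> from the balanced measure combine to a power independent of \<open>c\<close>.\<close>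

lemma emeasure_mallows_product_factor:
  fixes p y :: "'j \<Rightarrow> int"
  assumes \<alpha>: "0 < \<alpha>" and J: "finite J" and p: "\<And>j. j \<in> J \<Longrightarrow> i < p j" and y: "\<And>j. j \<in> J \<Longrightarrow> y j \<le> x"
  shows "emeasure (mallows_product q \<alpha> M) {\<omega>. bij \<omega> \<and> (\<forall>j\<in>J. \<omega> (p j) \<le> y j)} =
    ennreal (1 + \<alpha> * q powr (real_of_int (x - i) + 1 / 2)) *
    emeasure (mallows_product q \<alpha> M) {\<omega>. bij \<omega> \<and> \<omega> i \<le> x \<and> (\<forall>j\<in>J. \<omega> (p j) \<le> y j)}"
proof -
  let ?N = "emeasure (mallows_product q \<alpha> M)" and ?w = "mallows_weight q \<alpha>"
  let ?a = "\<alpha> * q powr (real_of_int (x - i) + 1 / 2)"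
  let ?E = "\<lambda>\<omega>. \<forall>j\<in>J. \<omega> (p j) \<le> y j"
  note measurable_coordinate_perm[measurable]
  have pred: "Measurable.pred perm_space (\<lambda>\<omega>. \<omega> i \<le> x \<and> ?E \<omega>)" "Measurable.pred perm_space (\<lambda>\<omega>. x < \<omega> i \<and> ?E \<omega>)"
    using J by measurable
  have "?N {\<omega>. bij \<omega> \<and> x < \<omega> i \<and> ?E \<omega>} =
      (\<integral>\<^sup>+c. ennreal (?w (c + 1) * \<P>(\<sigma> in M. x < \<sigma> i + (c + 1) \<and> (\<forall>j\<in>J. \<sigma> (p j) + (c + 1) \<le> y j))) \<partial>count_space UNIV)"
    unfolding emeasure_mallows_product_event[OF \<alpha> pred(2)]
    by (rule nn_integral_bij_count_space[symmetric]) (rule bij_betw_byWitness[where f' = "\<lambda>c. c - 1"], auto)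
  also have "\<dots> = (\<integral>\<^sup>+c. ennreal ?a * ennreal (?w c * \<P>(\<sigma> in M. \<sigma> i + c \<le> x \<and> (\<forall>j\<in>J. \<sigma> (p j) + c \<le> y j))) \<partial>count_space UNIV)"
  proof (rule nn_integral_cong)
    fix c
    have "\<P>(\<sigma> in M. x < \<sigma> i + (c + 1) \<and> (\<forall>j\<in>J. \<sigma> (p j) + (c + 1) \<le> y j)) =
        \<P>(\<sigma> in M. x - c \<le> \<sigma> i \<and> (\<forall>j\<in>J. \<sigma> (p j) < y j - c))"
      by (intro arg_cong[where f = prob] Collect_cong conj_cong ball_cong refl) auto
    also have "\<dots> = q powi (x - c - i) * \<P>(\<sigma> in M. \<sigma> i \<le> x - c \<and> (\<forall>j\<in>J. \<sigma> (p j) \<le> y j - c))"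
      by (rule prob_raise_level) (use J p y in auto)
    also have "\<P>(\<sigma> in M. \<sigma> i \<le> x - c \<and> (\<forall>j\<in>J. \<sigma> (p j) \<le> y j - c)) =
        \<P>(\<sigma> in M. \<sigma> i + c \<le> x \<and> (\<forall>j\<in>J. \<sigma> (p j) + c \<le> y j))"
      by (intro arg_cong[where f = prob] Collect_cong conj_cong ball_cong refl) auto
    finally have *: "\<P>(\<sigma> in M. x < \<sigma> i + (c + 1) \<and> (\<forall>j\<in>J. \<sigma> (p j) + (c + 1) \<le> y j)) =
        q powi (x - c - i) * \<P>(\<sigma> in M. \<sigma> i + c \<le> x \<and> (\<forall>j\<in>J. \<sigma> (p j) + c \<le> y j))" .
    have "(real_of_int c + 1 / 2) + real_of_int (x - c - i) = real_of_int (x - i) + 1 / 2" by simp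
    moreover have "q powi (x - c - i) = q powr real_of_int (x - c - i)"
      using q_pos powr_real_of_int'[of q "x - c - i"] by simp
    ultimately have powers: "q powr (real_of_int c + 1 / 2) * q powi (x - c - i) = q powr (real_of_int (x - i) + 1 / 2)"
      by (simp only: powr_add[symmetric])
    have weights: "?w (c + 1) * (q powi (x - c - i) * z) = ?a * (?w c * z)" for z
      unfolding mallows_weight_Suc[OF q_pos \<alpha>] powers[symmetric] by (simp only: mult_ac)
    show "ennreal (?w (c + 1) * \<P>(\<sigma> in M. x < \<sigma> i + (c + 1) \<and> (\<forall>j\<in>J. \<sigma> (p j) + (c + 1) \<le> y j))) =
        ennreal ?a * ennreal (?w c * \<P>(\<sigma> in M. \<sigma> i + c \<le> x \<and> (\<forall>j\<in>J. \<sigma> (p j) + c \<le> y j)))"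
      unfolding * weights using \<alpha> mallows_weight_nonneg[OF q_pos q_less_1 \<alpha>, of c]
      by (intro ennreal_mult) auto
  qed
  also have "\<dots> = ennreal ?a * ?N {\<omega>. bij \<omega> \<and> \<omega> i \<le> x \<and> ?E \<omega>}"
    unfolding emeasure_mallows_product_event[OF \<alpha> pred(1)] by (rule nn_integral_cmult) simp
  finally have gt: "?N {\<omega>. bij \<omega> \<and> x < \<omega> i \<and> ?E \<omega>} = ennreal ?a * ?N {\<omega>. bij \<omega> \<and> \<omega> i \<le> x \<and> ?E \<omega>}" .
  let ?L = "{\<omega>. bij \<omega> \<and> \<omega> i \<le> x \<and> ?E \<omega>}" and ?G = "{\<omega>. bij \<omega> \<and> x < \<omega> i \<and> ?E \<omega>}"
  have "{\<omega>. bij \<omega> \<and> ?E \<omega>} = ?L \<union> ?G" by auto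
  then have "?N {\<omega>. bij \<omega> \<and> ?E \<omega>} = ?N (?L \<union> ?G)" by (rule arg_cong)
  also have "?N (?L \<union> ?G) = ?N ?L + ?N ?G"
    by (rule plus_emeasure[symmetric]) (use pred in \<open>auto simp: pred_def\<close>)
  also have "?N ?L + ?N ?G = ennreal (1 + ?a) * ?N ?L"
  proof -
    have "ennreal (1 + ?a) = ennreal 1 + ennreal ?a" using \<alpha> by (intro ennreal_plus) auto
    then show ?thesis unfolding gt by (simp only: distrib_right ennreal_1 mult_1)
  qed
  finally show ?thesis .
qed

end

theorem theorem1p3:
  fixes q \<alpha> :: real and k :: nat and x i :: "nat \<Rightarrow> int"
    and M0 :: "(int \<Rightarrow> int) measure"
  assumes "0 < q" "q < 1" "\<alpha> > 0" "k \<ge> 1"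
    and "is_balanced_mallows q M0"
    and "antimono_on {1..k} x"
    and "strict_mono_on {1..k} i"
  shows "measure (mallows_product q \<alpha> M0) {\<omega>. bij \<omega> \<and> (\<forall>j\<in>{1..k}. \<omega> (i j) \<le> x j)} =
         (\<Prod>j = 1..k. 1 / (1 + \<alpha> * q powr (real_of_int (x j - i j) + 1 / 2)))"
proof -
  have "prob_space M0"
    using assms(5) by (simp add: is_balanced_mallows_def q_exchangeable_def)
  then interpret balanced_mallows M0 q
    using assms(1,2,5)
    by (auto intro!: balanced_mallows.intro q_exchangeable_permutation.intro q_exchangeable_permutation_axioms.intro
        balanced_mallows_axioms.intro simp: is_balanced_mallows_def)
  define a where "a j = \<alpha> * q powr (real_of_int (x j - i j) + 1 / 2)" for j
  have a: "0 \<le> a j" for j using assms(3) by (simp add: a_def)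
  let ?N = "emeasure (mallows_product q \<alpha> M0)"
  have "1 \<le> k + 1" using assms(4) by simp
  then have "?N {\<omega>. bij \<omega> \<and> (\<forall>j\<in>{1..k}. \<omega> (i j) \<le> x j)} = ennreal (\<Prod>j = 1..k. 1 / (1 + a j))"
    \<comment> \<open>The inequalities are removed from the left, so the statement is proved for \<open>{m..k}\<close> with \<open>m\<close>
      descending from \<open>k + 1\<close>.\<close>
  proof (induction rule: inc_induct)
    case base
    then show ?case
      using jacobi_triple_product_nn_integral[OF assms(1-3)]
        emeasure_mallows_product_event[OF assms(3), of "\<lambda>_. True"] prob_space by simp
  next
    case (step n)
    then have n: "{n..k} = insert n {Suc n..k}" "n \<in> {1..k}" by auto
    have later: "i n < i j" "x j \<le> x n" if "j \<in> {Suc n..k}" for j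
      using that n(2) assms(6,7) by (auto simp: monotone_on_def)
    let ?e = "?N {\<omega>. bij \<omega> \<and> (\<forall>j\<in>{n..k}. \<omega> (i j) \<le> x j)}"
    have "ennreal (\<Prod>j = Suc n..k. 1 / (1 + a j)) = ennreal (1 + a n) * ?e"
      using emeasure_mallows_product_factor[OF assms(3), of "{Suc n..k}" "i n" i x "x n"] later step.IH
      by (simp add: a_def n(1))
    then have "ennreal (1 / (1 + a n)) * ennreal (\<Prod>j = Suc n..k. 1 / (1 + a j)) =
        ennreal (1 / (1 + a n)) * ennreal (1 + a n) * ?e"
      by (simp only: mult.assoc)
    moreover have "ennreal (1 / (1 + a n)) * ennreal (1 + a n) = 1"
    proof -
      have "1 + a n \<noteq> 0" using a[of n] by linarith
      then show ?thesis using a[of n] by (subst ennreal_mult[symmetric]) simp_all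
    qed
    moreover have "ennreal (1 / (1 + a n)) * ennreal (\<Prod>j = Suc n..k. 1 / (1 + a j)) = ennreal (\<Prod>j = n..k. 1 / (1 + a j))"
      using a by (simp add: n(1) ennreal_mult[symmetric] prod_nonneg)
    ultimately show ?case by simp
  qed
  moreover have "0 \<le> (\<Prod>j = 1..k. 1 / (1 + a j))" using a by (intro prod_nonneg) simp
  ultimately show ?thesis by (simp add: measure_def a_def)
qed

end
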